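(* Assume the setup of the context, that $\mu$ is not a Dirac mass, and that the limit defining $\chi(v)$ exists for every admissible $v$. Let $v_0$ be admissible and $E_0=\chi(v_0)$. Then for every compact $K\subset\mathbb R^m$ and every $\varepsilon>0$ there exists $\eta>0$ such that for every $E\in\mathbb R^{d^+\times d^-}$ of full rank $\min\{d^+,d^-\}$ with $\|E-E_0\|<\eta$ there exists an admissible $v$ with $\|v-v_0\|_{C^r(K)}<\varepsilon$ and $\chi(v)=E$.
   Context: Let $r\ge1$, $\Lambda\subset\mathbb R^m$ compact, and $g\in C^r(\mathbb R^m,\mathbb R^m)$ such that $\Lambda$ is invariant under the flow $g_t$ of $\dot y=g(y)$. Let $\mu$ be a Borel probability measure on $\Lambda$ that is $g_t$-invariant, ergodic and mixing. Let $R\in\mathbb R^{m\times m}$ with $R^2=I$, $R(\Lambda)=\Lambda$, $\mu$ $R$-invariant, and $g(Ry)=-Rg(y)$ for all $y\in\Lambda$. Let $d=d^++d^-$ and $A=\mathrm{diag}(I_{d^+},-I_{d^-})$. A function $v\in C^r(\mathbb R^m,\mathbb R^d)$ is admissible if $v(Ry)=Av(y)$ for all $y\in\Lambda$ and $\int_\Lambda v\,d\mu=0$; write $v=(v^+,v^-)$ with $v^\pm$ valued in $\mathbb R^{d^\pm}$ and set $\chi(v)=2\lim_{T\to\infty}\int_0^T\int_\Lambda v^+\otimes(v^-\circ g_t)\,d\mu\,dt\in\mathbb R^{d^+\times d^-}$, where $u\otimes w=uw^T$. $\|w\|_{C^r(K)}$ is the supremum over $K$ of all partial derivatives of $w$ of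 order $0,\dots,r$. *)

theory Defs
  imports "HOL-Probability.Probability"
begin

definition partial :: "'m::finite \<Rightarrow> (real^'m \<Rightarrow> 'b::real_normed_vector) \<Rightarrow> real^'m \<Rightarrow> 'b" where
  "partial i f x = frechet_derivative f (at x) (axis i 1)"

fun dpartial :: "'m::finite list \<Rightarrow> (real^'m \<Rightarrow> 'b::real_normed_vector) \<Rightarrow> real^'m \<Rightarrow> 'b" where
  "dpartial [] f = f"
| "dpartial (i # is) f = partial i (dpartial is f)"

fun Ck :: "nat \<Rightarrow> (real^'m::finite \<Rightarrow> 'b::real_normed_vector) \<Rightarrow> bool" where
  "Ck 0 f = continuous_on UNIV f"
| "Ck (Suc k) f = ((\<forall>x. f differentiable (at x)) \<and> (\<forall>i. Ck k (partial i f)))"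

text \<open>The C^r(K) norm: supremum over K of (the Euclidean norms of) all partial
  derivatives of order 0,...,r. (0 is inserted only to make the sup well-defined for K = {}.)\<close>
definition Crnorm :: "nat \<Rightarrow> (real^'m::finite) set \<Rightarrow> (real^'m \<Rightarrow> 'b::real_normed_vector) \<Rightarrow> real" where
  "Crnorm r K w = Sup (insert 0 {norm (dpartial is w x) | is x. length is \<le> r \<and> x \<in> K})"

definition flow_on :: "(real^'m::finite \<Rightarrow> real^'m) \<Rightarrow> (real^'m) set \<Rightarrow> (real \<Rightarrow> real^'m \<Rightarrow> real^'m) \<Rightarrow> bool" where
  "flow_on g \<Lambda> \<phi> \<longleftrightarrow> (\<forall>y\<in>\<Lambda>. \<phi> 0 y = y \<and> (\<forall>t. \<phi> t y \<in> \<Lambda>)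
      \<and> (\<forall>t. ((\<lambda>s. \<phi> s y) has_vector_derivative g (\<phi> t y)) (at t)))"

definition flow_invariant :: "'a measure \<Rightarrow> (real \<Rightarrow> 'a \<Rightarrow> 'a) \<Rightarrow> bool" where
  "flow_invariant \<mu> \<phi> \<longleftrightarrow> (\<forall>t. \<phi> t \<in> measurable \<mu> \<mu> \<and> distr \<mu> \<mu> (\<phi> t) = \<mu>)"

definition flow_ergodic :: "'a measure \<Rightarrow> (real \<Rightarrow> 'a \<Rightarrow> 'a) \<Rightarrow> bool" where
  "flow_ergodic \<mu> \<phi> \<longleftrightarrow> (\<forall>A\<in>sets \<mu>. (\<forall>t. \<phi> t -` A \<inter> space \<mu> = A) \<longrightarrow>
      measure \<mu> A = 0 \<or> measure \<mu> A = 1)"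

definition flow_mixing :: "'a measure \<Rightarrow> (real \<Rightarrow> 'a \<Rightarrow> 'a) \<Rightarrow> bool" where
  "flow_mixing \<mu> \<phi> \<longleftrightarrow> (\<forall>A\<in>sets \<mu>. \<forall>B\<in>sets \<mu>.
      ((\<lambda>t. measure \<mu> (\<phi> t -` A \<inter> space \<mu> \<inter> B)) \<longlongrightarrow> measure \<mu> A * measure \<mu> B) at_top)"

definition is_dirac :: "'a measure \<Rightarrow> bool" where
  "is_dirac \<mu> \<longleftrightarrow> (\<exists>y\<in>space \<mu>. \<forall>A\<in>sets \<mu>. emeasure \<mu> A = indicator A y)"

text \<open>R^d with d = d^+ + d^- is modelled as real^('p + 'q): the Inl-coordinates are v^+,
  the Inr-coordinates are v^-. A = diag(I_{d^+}, -I_{d^-}).\<close>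
definition Amat :: "real^('p::finite + 'q::finite)^('p + 'q)" where
  "Amat = (\<chi> i j. if i = j then (case i of Inl _ \<Rightarrow> 1 | Inr _ \<Rightarrow> -1) else 0)"

definition vplus :: "(real^'m \<Rightarrow> real^('p::finite + 'q::finite)) \<Rightarrow> real^'m \<Rightarrow> real^'p" where
  "vplus v y = (\<chi> i. v y $ Inl i)"

definition vminus :: "(real^'m \<Rightarrow> real^('p::finite + 'q::finite)) \<Rightarrow> real^'m \<Rightarrow> real^'q" where
  "vminus v y = (\<chi> j. v y $ Inr j)"

definition admissible :: "nat \<Rightarrow> real^'m::finite^'m \<Rightarrow> (real^'m) measure
    \<Rightarrow> (real^'m \<Rightarrow> real^('p::finite + 'q::finite)) \<Rightarrow> bool" where
  "admissible r R \<mu> v \<longleftrightarrow> Ck r v \<and> (\<forall>y\<in>space \<mu>. v (R *v y) = Amat *v v y)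
      \<and> integral\<^sup>L \<mu> v = 0"

definition outer :: "real^'p \<Rightarrow> real^'q \<Rightarrow> real^'q^'p" where
  "outer u w = (\<chi> i j. u $ i * w $ j)"

definition corr :: "(real^'m) measure \<Rightarrow> (real \<Rightarrow> real^'m \<Rightarrow> real^'m)
    \<Rightarrow> (real^'m \<Rightarrow> real^('p::finite + 'q::finite)) \<Rightarrow> real \<Rightarrow> real^'q^'p" where
  "corr \<mu> \<phi> v t = integral\<^sup>L \<mu> (\<lambda>y. outer (vplus v y) (vminus v (\<phi> t y)))"

definition chi_exists :: "(real^'m) measure \<Rightarrow> (real \<Rightarrow> real^'m \<Rightarrow> real^'m)
    \<Rightarrow> (real^'m \<Rightarrow> real^('p::finite + 'q::finite)) \<Rightarrow> bool" where
  "chi_exists \<mu> \<phi> v \<longleftrightarrow> (\<exists>L. ((\<lambda>T. integral {0..T} (corr \<mu> \<phi> v)) \<longlongrightarrow> L) at_top)"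

definition chi :: "(real^'m) measure \<Rightarrow> (real \<Rightarrow> real^'m \<Rightarrow> real^'m)
    \<Rightarrow> (real^'m \<Rightarrow> real^('p::finite + 'q::finite)) \<Rightarrow> real^'q^'p" where
  "chi \<mu> \<phi> v = 2 *\<^sub>R Lim at_top (\<lambda>T. integral {0..T} (corr \<mu> \<phi> v))"

end

theory Submission
  imports Defs
begin

text \<open>
  The Lie derivative X f of an even function f along the flow is odd, and since X f composed with
  the flow is a time derivative, mixing gives
  2 * (integral over t from 0 to infinity of the correlation of u with X f at time t)
  = - 2 * (integral of u f) whenever f has mean zero. Thus chi, as a bilinear form in the even and
  odd parts, restricts on pairs (f, X f') to a multiple of the inner product of L2(mu). Because mu is
  not Dirac, some even polynomial P takes infinitely many values mu-almost everywhere, so the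
  polynomials in P are linearly independent in L2(mu), and among them one finds an orthonormal family
  f_1, ..., f_p satisfying any finite number of further linear conditions: mean zero, orthogonality
  to the even part of v0, and vanishing correlation integral with the odd part of v0. Adding
  delta * f_i to the even coordinates of v0 and the combination of the X f_k with coefficients
  - (E - chi v0)_kj / (2 * delta) to the odd ones changes chi v0 exactly to E, and this perturbation
  is small once delta is small and E is close enough to chi v0.
\<close>

section \<open>Functions of class $C^k$ and their norms\<close>

lemma partial_eq:
  assumes "(f has_derivative f') (at x)"
  shows "partial i f x = f' (axis i 1)"
  using frechet_derivative_at[OF assms] by (simp add: partial_def)

lemma Ck_imp_continuous: "Ck k f \<Longrightarrow> continuous_on UNIV f"
  by (cases k) (auto simp: continuous_at_imp_continuous_on differentiable_imp_continuous_within)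

lemma Ck_SucD: "Ck (Suc k) f \<Longrightarrow> Ck k f"
proof (induction k arbitrary: f)
  case 0
  then show ?case using Ck_imp_continuous[of "Suc 0" f] by simp
next
  case (Suc k)
  then show ?case by (metis Ck.simps(2))
qed

lemma partial_bounded_linear:
  assumes "bounded_linear L" "f differentiable (at x)"
  shows "partial i (\<lambda>x. L (f x)) x = L (partial i f x)"
proof -
  have "(f has_derivative frechet_derivative f (at x)) (at x)"
    using assms(2) frechet_derivative_works by blast
  from bounded_linear.has_derivative[OF assms(1) this] show ?thesis
    by (auto dest: partial_eq simp: partial_def[of i f])
qed

lemma Ck_bounded_linear:
  assumes "bounded_linear L"
  shows "Ck k f \<Longrightarrow> Ck k (\<lambda>x. L (f x))"
proof (induction k arbitrary: f)
  case 0
  then show ?case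
    using bounded_linear.continuous_on[OF assms] by auto
next
  case (Suc k)
  then have "partial i (\<lambda>x. L (f x)) = (\<lambda>x. L (partial i f x))" for i
    by (intro ext partial_bounded_linear[OF assms]) auto
  moreover have "(\<lambda>x. L (f x)) differentiable (at x)" for x
    using Suc.prems bounded_linear.has_derivative[OF assms] unfolding differentiable_def Ck.simps by blast
  ultimately show ?case using Suc by auto
qed

lemma Ck_const [simp]: "Ck k (\<lambda>x :: real^'m::finite. c)"
proof (induction k arbitrary: c)
  case (Suc k)
  have "partial i (\<lambda>x. c) = (\<lambda>x. 0)" for i :: 'm
    by (rule ext, subst partial_eq[OF has_derivative_const]) simp
  then show ?case using Suc by auto
qed auto

lemma Ck_linear:
  assumes "bounded_linear L"
  shows "Ck k L"
proof (cases k)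
  case 0
  then show ?thesis using linear_continuous_on[OF assms] by auto
next
  case (Suc k)
  have d: "(L has_derivative L) (at x)" for x
    using bounded_linear_imp_has_derivative[OF assms] .
  then have "partial i L = (\<lambda>x. L (axis i 1))" for i
    using partial_eq by blast
  then show ?thesis using Suc d by (auto simp: differentiable_def)
qed

lemma partial_add:
  assumes "f differentiable (at x)" "h differentiable (at x)"
  shows "partial i (\<lambda>x. f x + h x) x = partial i f x + partial i h x"
  using partial_eq[OF has_derivative_add[OF assms[unfolded frechet_derivative_works]]]
  by (simp add: partial_def)

lemma Ck_add: "Ck k f \<Longrightarrow> Ck k h \<Longrightarrow> Ck k (\<lambda>x. f x + h x)"
proof (induction k arbitrary: f h)
  case 0
  then show ?case by (auto intro: continuous_intros)
next
  case (Suc k)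
  then have "partial i (\<lambda>x. f x + h x) = (\<lambda>x. partial i f x + partial i h x)" for i
    by (intro ext partial_add) auto
  with Suc show ?case by auto
qed

lemma Ck_sum: "(\<And>i. i \<in> I \<Longrightarrow> Ck k (f i)) \<Longrightarrow> Ck k (\<lambda>x. \<Sum>i\<in>I. f i x)"
  by (induction I rule: infinite_finite_induct) (auto intro: Ck_add)

lemma Ck_scaleR: "Ck k f \<Longrightarrow> Ck k (\<lambda>x. c *\<^sub>R f x)"
  by (rule Ck_bounded_linear[OF bounded_linear_scaleR_right])

lemma Ck_mult:
  fixes f h :: "real^'m::finite \<Rightarrow> real"
  shows "Ck k f \<Longrightarrow> Ck k h \<Longrightarrow> Ck k (\<lambda>x. f x * h x)"
proof (induction k arbitrary: f h)
  case 0
  then show ?case by (auto intro: continuous_intros)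
next
  case (Suc k)
  then have d: "f differentiable (at x)" "h differentiable (at x)" for x by auto
  have "partial i (\<lambda>x. f x * h x) = (\<lambda>x. f x * partial i h x + partial i f x * h x)" for i
  proof
    fix x
    show "partial i (\<lambda>x. f x * h x) x = f x * partial i h x + partial i f x * h x"
      using partial_eq[OF has_derivative_mult[OF d[unfolded frechet_derivative_works]], of i x]
      by (simp add: partial_def)
  qed
  moreover have "Ck k f" "Ck k h" using Suc.prems Ck_SucD by blast+
  ultimately show ?case using Suc d by (auto intro!: Ck_add)
qed

lemma Ck_poly:
  fixes f :: "real^'m::finite \<Rightarrow> real"
  assumes "Ck k f"
  shows "Ck k (\<lambda>x. poly c (f x))"
proof (induction c)
  case (pCons a c)
  then show ?case using assms by (auto intro!: Ck_add Ck_mult)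
qed auto

lemma Ck_nth: "Ck k v \<Longrightarrow> Ck k (\<lambda>x. v x $ i)"
  by (rule Ck_bounded_linear[OF bounded_linear_vec_nth])

lemma dpartial_append: "dpartial (is @ js) f = dpartial is (dpartial js f)"
  by (induction "is") auto

text \<open>\<open>dpartial\<close> applies the last entry of its list first, and \<open>Ck\<close>
  likewise peels off the innermost derivative first. Hence the induction runs from the end of the
  list.\<close>

lemma Ck_dpartial: "Ck (k + length is) f \<Longrightarrow> Ck k (dpartial is f)"
proof (induction "is" arbitrary: f rule: rev_induct)
  case (snoc i "is")
  then show ?case by (auto simp: dpartial_append)
qed auto

lemma dpartial_differentiable:
  assumes "Ck k f" "length is < k"
  shows "dpartial is f differentiable (at x)"
proof -
  have "Ck (Suc (k - length is - 1)) (dpartial is f)"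
    by (rule Ck_dpartial) (use assms in auto)
  then show ?thesis by auto
qed

lemma dpartial_add:
  assumes "Ck k f" "Ck k h" "length is \<le> k"
  shows "dpartial is (\<lambda>x. f x + h x) = (\<lambda>x. dpartial is f x + dpartial is h x)"
  using assms(3)
proof (induction "is")
  case (Cons i "is")
  then have "partial i (\<lambda>x. dpartial is f x + dpartial is h x) x = partial i (dpartial is f) x + partial i (dpartial is h) x" for x
    using assms by (intro partial_add dpartial_differentiable[of k]) auto
  with Cons show ?case by simp
qed auto

lemma dpartial_scaleR:
  assumes "Ck k f" "length is \<le> k"
  shows "dpartial is (\<lambda>x. c *\<^sub>R f x) = (\<lambda>x. c *\<^sub>R dpartial is f x)"
  using assms(2)
proof (induction "is")
  case (Cons i "is")
  then have "partial i (\<lambda>x. c *\<^sub>R dpartial is f x) x = c *\<^sub>R partial i (dpartial is f) x" for x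
    using assms
    by (intro partial_bounded_linear[OF bounded_linear_scaleR_right] dpartial_differentiable[of k]) auto
  with Cons show ?case by simp
qed auto

section \<open>The $C^r(K)$ norm: finiteness, subadditivity and scaling\<close>

text \<open>The coordinate type \<open>'m\<close> is finite, so there are only finitely many index
  lists of length at most r, and each of these derivatives is continuous, hence bounded on the
  compact K. Thus the \<open>Sup\<close> in \<open>Crnorm\<close> is a genuine supremum.\<close>

lemma Crnorm_bdd_above:
  fixes f :: "real^'m::finite \<Rightarrow> 'b::real_normed_vector"
  assumes "compact K" "Ck r f"
  shows "bdd_above (insert 0 {norm (dpartial is f x) | is x. length is \<le> r \<and> x \<in> K})"
proof -
  have "finite {is :: 'm list. length is \<le> r}"
    using finite_lists_length_le[of "UNIV :: 'm set" r] by simp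
  moreover have "bounded (dpartial is f ` K)" if "length is \<le> r" for "is"
  proof -
    have "Ck (r - length is) (dpartial is f)"
      by (rule Ck_dpartial) (use assms that in auto)
    then have "continuous_on K (dpartial is f)"
      using Ck_imp_continuous continuous_on_subset by blast
    then show ?thesis
      using assms(1) compact_continuous_image compact_imp_bounded by blast
  qed
  ultimately have "bounded (\<Union>is\<in>{is. length is \<le> r}. dpartial is f ` K)" by auto
  then obtain B where "\<And>is x. length is \<le> r \<Longrightarrow> x \<in> K \<Longrightarrow> norm (dpartial is f x) \<le> B"
    unfolding bounded_iff by auto
  then show ?thesis by (intro bdd_aboveI[of _ "max 0 B"]) fastforce
qed

lemma norm_dpartial_le_Crnorm:
  assumes "compact K" "Ck r f" "length is \<le> r" "x \<in> K"
  shows "norm (dpartial is f x) \<le> Crnorm r K f"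
  unfolding Crnorm_def using assms by (intro cSup_upper[OF _ Crnorm_bdd_above]) auto

lemma Crnorm_nonneg:
  assumes "compact K" "Ck r f"
  shows "0 \<le> Crnorm r K f"
  unfolding Crnorm_def using assms by (intro cSup_upper[OF _ Crnorm_bdd_above]) auto

lemma Crnorm_le:
  assumes "0 \<le> B" "\<And>is x. length is \<le> r \<Longrightarrow> x \<in> K \<Longrightarrow> norm (dpartial is f x) \<le> B"
  shows "Crnorm r K f \<le> B"
  unfolding Crnorm_def using assms by (intro cSup_least) auto

lemma Crnorm_add:
  fixes f :: "real^'m::finite \<Rightarrow> 'b::real_normed_vector"
  assumes "compact K" "Ck r f" "Ck r h"
  shows "Crnorm r K (\<lambda>x. f x + h x) \<le> Crnorm r K f + Crnorm r K h"
proof (rule Crnorm_le)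
  show "0 \<le> Crnorm r K f + Crnorm r K h"
    using Crnorm_nonneg[OF assms(1,2)] Crnorm_nonneg[OF assms(1,3)] by simp
  fix "is" :: "'m list" and x assume *: "length is \<le> r" "x \<in> K"
  have "norm (dpartial is f x + dpartial is h x) \<le> Crnorm r K f + Crnorm r K h"
    using norm_dpartial_le_Crnorm[OF assms(1,2) *] norm_dpartial_le_Crnorm[OF assms(1,3) *]
    by (rule order_trans[OF norm_triangle_ineq add_mono])
  then show "norm (dpartial is (\<lambda>x. f x + h x) x) \<le> Crnorm r K f + Crnorm r K h"
    using dpartial_add[OF assms(2,3) *(1)] by simp
qed

lemma Crnorm_scaleR:
  fixes f :: "real^'m::finite \<Rightarrow> 'b::real_normed_vector"
  assumes "compact K" "Ck r f"
  shows "Crnorm r K (\<lambda>x. c *\<^sub>R f x) \<le> \<bar>c\<bar> * Crnorm r K f"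
proof (rule Crnorm_le)
  show "0 \<le> \<bar>c\<bar> * Crnorm r K f"
    using Crnorm_nonneg[OF assms] by simp
  fix "is" :: "'m list" and x assume *: "length is \<le> r" "x \<in> K"
  then show "norm (dpartial is (\<lambda>x. c *\<^sub>R f x) x) \<le> \<bar>c\<bar> * Crnorm r K f"
    using norm_dpartial_le_Crnorm[OF assms *] dpartial_scaleR[OF assms(2) *(1)]
    by (simp add: mult_left_mono)
qed

lemma dpartial_zero: "dpartial is (\<lambda>x :: real^'m::finite. 0) = (\<lambda>x. 0)"
  using dpartial_scaleR[OF Ck_const order_refl, of "is" 0 0] by simp

lemma Crnorm_sum:
  assumes "compact K" "\<And>i. i \<in> I \<Longrightarrow> Ck r (f i)"
  shows "Crnorm r K (\<lambda>x. \<Sum>i\<in>I. f i x) \<le> (\<Sum>i\<in>I. Crnorm r K (f i))"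
proof -
  have z: "Crnorm r K (\<lambda>x. 0) \<le> 0"
    by (rule Crnorm_le) (auto simp: dpartial_zero)
  show ?thesis using assms(2)
  proof (induction I rule: infinite_finite_induct)
    case (insert i I)
    have "Crnorm r K (\<lambda>x. f i x + (\<Sum>i\<in>I. f i x)) \<le> Crnorm r K (f i) + Crnorm r K (\<lambda>x. \<Sum>i\<in>I. f i x)"
      using insert.prems by (intro Crnorm_add assms(1) Ck_sum) auto
    with insert.IH insert.prems insert.hyps show ?case by simp
  qed (use z in auto)
qed

section \<open>The Lie derivative along the vector field\<close>

text \<open>The coordinate form reduces smoothness to sums and products. By \<open>lie_eq\<close> it
  agrees with the derivative of f in the direction g(x) wherever f is differentiable.\<close>

definition lie :: "(real^'m::finite \<Rightarrow> real^'m) \<Rightarrow> (real^'m \<Rightarrow> real) \<Rightarrow> real^'m \<Rightarrow> real" where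
  "lie g f x = (\<Sum>i\<in>UNIV. partial i f x * g x $ i)"

lemma lie_eq:
  assumes "(f has_derivative f') (at x)"
  shows "lie g f x = f' (g x)"
proof -
  interpret bounded_linear f' using assms has_derivative_bounded_linear by blast
  have "f' (g x) = f' (\<Sum>i\<in>UNIV. g x $ i *\<^sub>R axis i 1)"
    by (simp add: basis_expansion scalar_mult_eq_scaleR[symmetric])
  then show ?thesis
    by (simp add: lie_def partial_eq[OF assms] sum scaleR mult.commute)
qed

lemma Ck_lie: "Ck (Suc r) f \<Longrightarrow> Ck r g \<Longrightarrow> Ck r (lie g f)"
  unfolding lie_def[abs_def] by (intro Ck_sum Ck_mult Ck_nth) auto

text \<open>Differentiating f(Rx) = f(x) at y gives Df(Ry)(Rw) = Df(y)(w). With w = g(y), the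
  reversing symmetry g(Ry) = -R g(y) supplies the sign. Evenness is assumed on the whole space
  because the derivative at y sees a full neighbourhood.\<close>

lemma lie_odd:
  assumes f: "\<And>x. f differentiable (at x)" and ev: "\<And>x. f (R *v x) = f x"
    and g: "g (R *v y) = - (R *v g y)"
  shows "lie g f (R *v y) = - lie g f y"
proof -
  obtain f' where f': "(f has_derivative f') (at (R *v y))"
    using f differentiable_def by blast
  have "((\<lambda>x. f (R *v x)) has_derivative (\<lambda>x. f' (R *v x))) (at y)"
    by (rule has_derivative_compose[where f = "(*v) R", OF _ f'])
      (rule bounded_linear_imp_has_derivative, rule matrix_vector_mul_bounded_linear)
  then have "lie g f y = f' (R *v g y)"
    using ev lie_eq by fastforce
  moreover interpret bounded_linear f' using f' has_derivative_bounded_linear by blast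
  have "lie g f (R *v y) = - f' (R *v g y)"
    by (simp add: lie_eq[OF f'] g neg)
  ultimately show ?thesis by simp
qed

lemma Ck_vec:
  fixes v :: "real^'m::finite \<Rightarrow> real^'n::finite"
  assumes "\<And>k. Ck r (\<lambda>x. v x $ k)"
  shows "Ck r v"
proof -
  have "Ck r (\<lambda>x. \<Sum>k\<in>UNIV. v x $ k *\<^sub>R axis k (1::real))"
    by (intro Ck_sum Ck_bounded_linear[OF bounded_linear_scaleR_left] assms)
  moreover have "(\<lambda>x. \<Sum>k\<in>UNIV. v x $ k *\<^sub>R axis k (1::real)) = v"
    by (simp add: basis_expansion scalar_mult_eq_scaleR[symmetric])
  ultimately show ?thesis by simp
qed

lemma Amat_mult_nth [simp]:
  "(Amat *v w) $ Inl i = w $ Inl i" "(Amat *v w) $ Inr j = - w $ Inr j"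
  by (simp_all add: Amat_def matrix_vector_mult_def if_distrib[of "\<lambda>a. a * _"] cong: if_cong)

section \<open>Polynomials annihilated by finitely many functionals\<close>

text \<open>The unbounded degree makes the elimination of one functional at a time preserve nonzeroness.\<close>
lemma ex_poly_annihilated:
  fixes l :: "'k \<Rightarrow> real poly \<Rightarrow> real"
  assumes "finite I"
    and "\<And>i p q. i \<in> I \<Longrightarrow> l i (p + q) = l i p + l i q"
    and "\<And>i a p. i \<in> I \<Longrightarrow> l i (smult a p) = a * l i p"
  shows "\<exists>c. c \<noteq> 0 \<and> degree c \<ge> n \<and> (\<forall>i\<in>I. l i c = 0)"
  using assms
proof (induction I arbitrary: n rule: finite_induct)
  case empty
  then show ?case by (intro exI[of _ "monom 1 n"]) (auto simp: degree_monom_eq)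
next
  case (insert i I)
  note IH = insert.IH[OF insert.prems[OF insertI2]]
  obtain c where c: "c \<noteq> 0" "degree c \<ge> n" "\<forall>i\<in>I. l i c = 0"
    using IH by blast
  \<comment> \<open>A degree above that of c protects the leading term of d when a multiple of c is
    added to cancel the new functional.\<close>
  obtain d where d: "d \<noteq> 0" "degree d \<ge> Suc (degree c)" "\<forall>i\<in>I. l i d = 0"
    using IH by blast
  show ?case
  proof (cases "l i c = 0")
    case True
    then show ?thesis using c by auto
  next
    case False
    define e where "e = d + smult (- (l i d / l i c)) c"
    have deg: "degree e = degree d"
      unfolding e_def using d(2) degree_smult_le[of _ c] by (intro degree_add_eq_left) (meson Suc_le_lessD le_less_trans)
    moreover have "l j e = 0" if "j \<in> insert i I" for j
    proof -
      have "l j e = l j d - l i d / l i c * l j c"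
        unfolding e_def insert.prems(1)[OF that] insert.prems(2)[OF that] by simp
      then show ?thesis using that False c(3) d(3) by auto
    qed
    moreover have "e \<noteq> 0" using deg d by auto
    ultimately show ?thesis using c d by (intro exI[of _ e]) auto
  qed
qed

text \<open>Orthogonality to the polynomials already chosen is itself a finite set of linear
  conditions, namely the functionals \<open>Q (c s)\<close>. They are imposed together with the
  given functionals by \<open>ex_poly_annihilated\<close>, and positivity of Q allows the new
  polynomial to be normalised.\<close>

lemma ex_orthonormal_poly_annihilated:
  fixes l :: "'k \<Rightarrow> real poly \<Rightarrow> real" and Q :: "real poly \<Rightarrow> real poly \<Rightarrow> real"
  assumes I: "finite I" and S: "finite S"
    and add: "\<And>i p q. i \<in> I \<Longrightarrow> l i (p + q) = l i p + l i q"
    and smult: "\<And>i a p. i \<in> I \<Longrightarrow> l i (smult a p) = a * l i p"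
    and Q_add: "\<And>p q r. Q r (p + q) = Q r p + Q r q"
    and Q_smult: "\<And>a p r. Q r (smult a p) = a * Q r p"
    and Q_sym: "\<And>p q. Q p q = Q q p"
    and Q_pos: "\<And>p. p \<noteq> 0 \<Longrightarrow> Q p p > 0"
  shows "\<exists>c :: 'i \<Rightarrow> real poly. (\<forall>s\<in>S. \<forall>i\<in>I. l i (c s) = 0) \<and>
      (\<forall>s\<in>S. \<forall>t\<in>S. Q (c s) (c t) = (if s = t then 1 else 0))"
  using S
proof (induction S rule: finite_induct)
  case empty
  then show ?case by simp
next
  case (insert x S)
  then obtain c :: "'i \<Rightarrow> real poly" where c: "\<forall>s\<in>S. \<forall>i\<in>I. l i (c s) = 0"
    "\<forall>s\<in>S. \<forall>t\<in>S. Q (c s) (c t) = (if s = t then 1 else 0)" by blast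
  have "\<exists>d. d \<noteq> 0 \<and> degree d \<ge> 0 \<and> (\<forall>k\<in>Inl ` I \<union> Inr ` S. case_sum l (\<lambda>s. Q (c s)) k d = 0)"
    by (rule ex_poly_annihilated) (use I insert.hyps add smult Q_add Q_smult in auto)
  then obtain d where d0: "d \<noteq> 0"
    and d1: "\<forall>k\<in>Inl ` I \<union> Inr ` S. case_sum l (\<lambda>s. Q (c s)) k d = 0" by blast
  have d: "d \<noteq> 0" "\<forall>i\<in>I. l i d = 0" "\<forall>s\<in>S. Q (c s) d = 0" using d0 d1 by (simp_all add: ball_Un)
  define e where "e = smult (1 / sqrt (Q d d)) d"
  have le: "\<forall>i\<in>I. l i e = 0" using d smult by (simp add: e_def)
  have Qe: "\<forall>s\<in>S. Q (c s) e = 0" using d Q_smult by (simp add: e_def)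
  have "Q e e = 1 / sqrt (Q d d) * Q e d"
    using Q_smult[of e "1 / sqrt (Q d d)" d] by (simp only: e_def)
  also have "\<dots> = 1 / sqrt (Q d d) * Q d e"
    by (simp only: Q_sym)
  also have "\<dots> = 1 / sqrt (Q d d) * (1 / sqrt (Q d d)) * Q d d"
    unfolding e_def Q_smult by simp
  also have "\<dots> = 1" using Q_pos[OF d(1)] by simp
  finally have "Q e e = 1" .
  moreover have "\<forall>s\<in>S. Q e (c s) = 0"
    using Qe Q_sym by metis
  ultimately show ?case
    using c le Qe insert.hyps by (intro exI[of _ "c(x := e)"]) auto
qed

section \<open>Correlations of a mixing flow\<close>

locale mixing_flow = prob_space \<mu> for \<mu> :: "(real^'m::finite) measure" +
  fixes \<Lambda> :: "(real^'m) set" and g :: "real^'m \<Rightarrow> real^'m" and \<phi> :: "real \<Rightarrow> real^'m \<Rightarrow> real^'m"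
  assumes compact: "compact \<Lambda>"
    and space_eq: "space \<mu> = \<Lambda>"
    and sets_eq: "sets \<mu> = sets (restrict_space borel \<Lambda>)"
    and flow: "flow_on g \<Lambda> \<phi>"
    and inv: "flow_invariant \<mu> \<phi>"
    and mix: "flow_mixing \<mu> \<phi>"
    and cont_g: "continuous_on UNIV g"
begin

text \<open>The entries of \<open>corr\<close> are of this form, with f an even and h an odd
  coordinate of the same function. Scalar pairs can be varied independently, which exposes the
  bilinearity.\<close>

definition correlation :: "(real^'m \<Rightarrow> real) \<Rightarrow> (real^'m \<Rightarrow> real) \<Rightarrow> real \<Rightarrow> real" where
  "correlation f h t = (\<integral>y. f y * h (\<phi> t y) \<partial>\<mu>)"

lemma measurable_continuous:
  fixes f :: "real^'m \<Rightarrow> 'b::topological_space"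
  assumes "continuous_on UNIV f"
  shows "f \<in> borel_measurable \<mu>"
proof -
  have "f \<in> borel_measurable (restrict_space borel \<Lambda>)"
    using assms by (intro measurable_restrict_space1 borel_measurable_continuous_onI)
  then show ?thesis using measurable_cong_sets[OF sets_eq refl] by blast
qed

lemma flow_measurable [measurable]: "\<phi> t \<in> measurable \<mu> \<mu>"
  using inv by (auto simp: flow_invariant_def)

lemma flow_distr: "distr \<mu> \<mu> (\<phi> t) = \<mu>"
  using inv by (auto simp: flow_invariant_def)

lemma flow_in: "y \<in> \<Lambda> \<Longrightarrow> \<phi> t y \<in> \<Lambda>"
  using flow by (auto simp: flow_on_def)

lemma flow_0: "y \<in> \<Lambda> \<Longrightarrow> \<phi> 0 y = y"
  using flow by (auto simp: flow_on_def)

lemma flow_deriv: "y \<in> \<Lambda> \<Longrightarrow> ((\<lambda>s. \<phi> s y) has_vector_derivative g (\<phi> t y)) (at t)"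
  using flow by (auto simp: flow_on_def)

lemma flow_continuous: "y \<in> \<Lambda> \<Longrightarrow> continuous_on UNIV (\<lambda>s. \<phi> s y)"
  by (intro continuous_at_imp_continuous_on ballI has_vector_derivative_continuous[OF flow_deriv])

lemma bounded_on_carrier:
  fixes f :: "real^'m \<Rightarrow> real"
  assumes "continuous_on UNIV f"
  obtains B where "B \<ge> 0" "\<And>y. y \<in> \<Lambda> \<Longrightarrow> \<bar>f y\<bar> \<le> B"
proof -
  have "bounded (f ` \<Lambda>)"
    by (intro compact_imp_bounded compact_continuous_image compact continuous_on_subset[OF assms]) simp
  then obtain B where "\<And>y. y \<in> \<Lambda> \<Longrightarrow> \<bar>f y\<bar> \<le> B"
    by (auto simp: bounded_iff)
  then show ?thesis by (intro that[of "max 0 B"]) (auto simp: le_max_iff_disj)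
qed

lemma integrable_bounded:
  fixes f :: "real^'m \<Rightarrow> real"
  assumes "f \<in> borel_measurable \<mu>" "\<And>y. y \<in> \<Lambda> \<Longrightarrow> \<bar>f y\<bar> \<le> B"
  shows "integrable \<mu> f"
  using assms by (intro integrable_const_bound[of _ B]) (auto simp: space_eq)

lemma integrable_cont:
  fixes f :: "real^'m \<Rightarrow> real"
  assumes "continuous_on UNIV f"
  shows "integrable \<mu> f"
proof -
  obtain B where "B \<ge> 0" "\<And>y. y \<in> \<Lambda> \<Longrightarrow> \<bar>f y\<bar> \<le> B" by (rule bounded_on_carrier[OF assms]) blast
  then show ?thesis using integrable_bounded measurable_continuous[OF assms] by blast
qed

lemma measurable_flow_comp:
  assumes "continuous_on UNIV h"
  shows "(\<lambda>y. h (\<phi> t y)) \<in> borel_measurable \<mu>"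
  using measurable_compose[OF flow_measurable measurable_continuous[OF assms]] .

lemma integrable_correlation:
  fixes f h :: "real^'m \<Rightarrow> real"
  assumes "continuous_on UNIV f" "continuous_on UNIV h"
  shows "integrable \<mu> (\<lambda>y. f y * h (\<phi> t y))"
proof -
  obtain A where A: "A \<ge> 0" "\<And>y. y \<in> \<Lambda> \<Longrightarrow> \<bar>f y\<bar> \<le> A" by (rule bounded_on_carrier[OF assms(1)]) blast
  obtain B where B: "B \<ge> 0" "\<And>y. y \<in> \<Lambda> \<Longrightarrow> \<bar>h y\<bar> \<le> B" by (rule bounded_on_carrier[OF assms(2)]) blast
  show ?thesis
    using A B flow_in measurable_continuous[OF assms(1)] measurable_flow_comp[OF assms(2)]
    by (intro integrable_bounded[of _ "A * B"]) (auto simp: abs_mult intro!: mult_mono)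
qed

text \<open>Dominated convergence along a sequence of times, with a constant as dominating function.
  Continuity in time guarantees that the integrals over [0, T] exist.\<close>

lemma correlation_continuous:
  assumes "continuous_on UNIV f" "continuous_on UNIV h"
  shows "continuous_on S (correlation f h)"
proof (rule continuous_on_sequentiallyI)
  fix u :: "nat \<Rightarrow> real" and a assume u: "u \<longlonglongrightarrow> a"
  obtain A where A: "A \<ge> 0" "\<And>y. y \<in> \<Lambda> \<Longrightarrow> \<bar>f y\<bar> \<le> A" by (rule bounded_on_carrier[OF assms(1)]) blast
  obtain B where B: "B \<ge> 0" "\<And>y. y \<in> \<Lambda> \<Longrightarrow> \<bar>h y\<bar> \<le> B" by (rule bounded_on_carrier[OF assms(2)]) blast
  show "(\<lambda>n. correlation f h (u n)) \<longlonglongrightarrow> correlation f h a"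
    unfolding correlation_def
  proof (rule integral_dominated_convergence[where w = "\<lambda>_. A * B"])
    show "AE y in \<mu>. (\<lambda>n. f y * h (\<phi> (u n) y)) \<longlonglongrightarrow> f y * h (\<phi> a y)"
    proof (rule AE_I2)
      fix y assume "y \<in> space \<mu>"
      then have "continuous_on UNIV (\<lambda>s. h (\<phi> s y))"
        using continuous_on_compose2[OF assms(2) flow_continuous] by (simp add: space_eq)
      then have "(\<lambda>n. h (\<phi> (u n) y)) \<longlonglongrightarrow> h (\<phi> a y)"
        by (rule continuous_on_tendsto_compose[OF _ u]) auto
      then show "(\<lambda>n. f y * h (\<phi> (u n) y)) \<longlonglongrightarrow> f y * h (\<phi> a y)" by (intro tendsto_intros)
    qed
    show "AE y in \<mu>. norm (f y * h (\<phi> (u n) y)) \<le> A * B" for n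
      using A B flow_in by (intro AE_I2) (auto simp: abs_mult space_eq intro!: mult_mono)
  qed (auto intro!: borel_measurable_integrable integrable_correlation assms)
qed

lemma correlation_integrable:
  assumes "continuous_on UNIV f" "continuous_on UNIV h"
  shows "correlation f h integrable_on {a..b}"
  using integrable_continuous_real[OF correlation_continuous[OF assms]] .

section \<open>Differentiating correlations in time\<close>

lemma flow_comp_deriv:
  assumes "\<And>x. f differentiable (at x)" "y \<in> \<Lambda>"
  shows "((\<lambda>s. f (\<phi> s y)) has_real_derivative lie g f (\<phi> t y)) (at t)"
proof -
  obtain f' where f': "(f has_derivative f') (at (\<phi> t y))"
    using assms(1) differentiable_def by blast
  have "((\<lambda>s. \<phi> s y) has_derivative (\<lambda>s. s *\<^sub>R g (\<phi> t y))) (at t)"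
    using flow_deriv[OF assms(2), of t] by (simp add: has_vector_derivative_def)
  from has_derivative_compose[OF this f']
  have "((\<lambda>s. f (\<phi> s y)) has_derivative (\<lambda>s. f' (s *\<^sub>R g (\<phi> t y)))) (at t)" .
  moreover interpret bounded_linear f' using f' has_derivative_bounded_linear by blast
  have "f' (s *\<^sub>R g (\<phi> t y)) = lie g f (\<phi> t y) * s" for s
    by (simp add: lie_eq[OF f'] scaleR)
  ultimately show ?thesis by (simp add: has_field_derivative_def)
qed

lemma lie_continuous: "Ck (Suc 0) f \<Longrightarrow> continuous_on UNIV (lie g f)"
  using Ck_lie[of 0 f g] cont_g by auto

text \<open>Differentiation under the integral sign. Orbits stay in the compact \<Lambda>, so by the
  mean value inequality the difference quotients of f along an orbit are bounded by the supremum of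
  |\<open>lie g f\<close>| on \<Lambda>; this gives the dominating constant.\<close>

lemma correlation_deriv:
  assumes u: "continuous_on UNIV u" and f: "Ck (Suc 0) f"
  shows "(correlation u f has_real_derivative correlation u (lie g f) t) (at t)"
  unfolding has_field_derivative_iff tendsto_at_iff_sequentially comp_def
proof (intro allI impI)
  fix X :: "nat \<Rightarrow> real" assume X: "\<forall>i. X i \<in> UNIV - {t}" "X \<longlonglongrightarrow> t"
  note cf = Ck_imp_continuous[OF f] and cl = lie_continuous[OF f]
  obtain A where A: "A \<ge> 0" "\<And>y. y \<in> \<Lambda> \<Longrightarrow> \<bar>u y\<bar> \<le> A" by (rule bounded_on_carrier[OF u]) blast
  obtain B where B: "B \<ge> 0" "\<And>y. y \<in> \<Lambda> \<Longrightarrow> \<bar>lie g f y\<bar> \<le> B" by (rule bounded_on_carrier[OF cl]) blast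
  have d: "((\<lambda>s. f (\<phi> s y)) has_real_derivative lie g f (\<phi> s y)) (at s)" if "y \<in> \<Lambda>" for s y
    using flow_comp_deriv that f by auto
  have eq: "(correlation u f (X n) - correlation u f t) / (X n - t) =
      (\<integral>y. u y * ((f (\<phi> (X n) y) - f (\<phi> t y)) / (X n - t)) \<partial>\<mu>)" for n
  proof -
    have "correlation u f (X n) - correlation u f t = (\<integral>y. u y * f (\<phi> (X n) y) - u y * f (\<phi> t y) \<partial>\<mu>)"
      unfolding correlation_def
      by (rule Bochner_Integration.integral_diff[symmetric, OF integrable_correlation[OF u cf] integrable_correlation[OF u cf]])
    then have "(correlation u f (X n) - correlation u f t) / (X n - t)
        = (\<integral>y. (u y * f (\<phi> (X n) y) - u y * f (\<phi> t y)) / (X n - t) \<partial>\<mu>)" by simp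
    then show ?thesis by (simp add: right_diff_distrib)
  qed
  show "(\<lambda>n. (correlation u f (X n) - correlation u f t) / (X n - t)) \<longlonglongrightarrow> correlation u (lie g f) t"
    unfolding eq unfolding correlation_def
  proof (rule integral_dominated_convergence[where w = "\<lambda>_. A * B"])
    show "AE y in \<mu>. (\<lambda>n. u y * ((f (\<phi> (X n) y) - f (\<phi> t y)) / (X n - t))) \<longlonglongrightarrow> u y * lie g f (\<phi> t y)"
    proof (rule AE_I2)
      fix y assume "y \<in> space \<mu>"
      then have "((\<lambda>s. (f (\<phi> s y) - f (\<phi> t y)) / (s - t)) \<longlongrightarrow> lie g f (\<phi> t y)) (at t)"
        using d[of y t] by (simp add: space_eq has_field_derivative_iff)
      then have "(\<lambda>n. (f (\<phi> (X n) y) - f (\<phi> t y)) / (X n - t)) \<longlonglongrightarrow> lie g f (\<phi> t y)"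
        using X unfolding tendsto_at_iff_sequentially comp_def by blast
      then show "(\<lambda>n. u y * ((f (\<phi> (X n) y) - f (\<phi> t y)) / (X n - t))) \<longlonglongrightarrow> u y * lie g f (\<phi> t y)"
        by (intro tendsto_intros)
    qed
    show "AE y in \<mu>. norm (u y * ((f (\<phi> (X n) y) - f (\<phi> t y)) / (X n - t))) \<le> A * B" for n
    proof (rule AE_I2)
      fix y assume "y \<in> space \<mu>"
      then have y: "y \<in> \<Lambda>" by (simp add: space_eq)
      have "norm (f (\<phi> (X n) y) - f (\<phi> t y)) \<le> B * norm (X n - t)"
        by (rule field_differentiable_bound[of UNIV "\<lambda>s. f (\<phi> s y)" "\<lambda>s. lie g f (\<phi> s y)"])
          (use d[OF y] B y flow_in in auto)
      then have "\<bar>(f (\<phi> (X n) y) - f (\<phi> t y)) / (X n - t)\<bar> \<le> B"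
        using X(1) by (simp add: divide_le_eq)
      then show "norm (u y * ((f (\<phi> (X n) y) - f (\<phi> t y)) / (X n - t))) \<le> A * B"
        unfolding real_norm_def abs_mult using A y by (intro mult_mono) auto
    qed
    show "(\<lambda>y. u y * lie g f (\<phi> t y)) \<in> borel_measurable \<mu>"
      by (rule borel_measurable_integrable[OF integrable_correlation[OF u cl]])
    show "(\<lambda>y. u y * ((f (\<phi> (X n) y) - f (\<phi> t y)) / (X n - t))) \<in> borel_measurable \<mu>" for n
      using measurable_continuous[OF u] measurable_flow_comp[OF cf]
      by (intro borel_measurable_times borel_measurable_divide borel_measurable_diff) auto
  qed auto
qed

lemma correlation_0: "correlation u f 0 = (\<integral>y. u y * f y \<partial>\<mu>)"
  unfolding correlation_def by (rule Bochner_Integration.integral_cong) (auto simp: space_eq flow_0)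

text \<open>The integrand is the time derivative of \<open>correlation u f\<close>, whose value at
  time 0 is the inner product of u and f.\<close>

lemma integral_correlation_lie:
  assumes "continuous_on UNIV u" "Ck (Suc 0) f" "0 \<le> T"
  shows "integral {0..T} (correlation u (lie g f)) = correlation u f T - (\<integral>y. u y * f y \<partial>\<mu>)"
proof -
  have "(correlation u (lie g f) has_integral correlation u f T - correlation u f 0) {0..T}"
    by (rule fundamental_theorem_of_calculus[OF assms(3)])
      (use correlation_deriv[OF assms(1,2)] in
        \<open>auto simp: has_real_derivative_iff_has_vector_derivative[symmetric] intro: has_field_derivative_at_within\<close>)
  then show ?thesis using correlation_0 by (simp add: integral_unique)
qed

section \<open>Mixing for continuous functions\<close>

text \<open>Round f down to the nearest multiple of e. Boundedness of f on \<Lambda> leaves finitely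
  many multiples, and the sets are the level sets of the rounded function.\<close>

lemma uniform_simple_approximation:
  fixes f :: "real^'m \<Rightarrow> real"
  assumes "continuous_on UNIV f" "e > 0"
  obtains I :: "int set" and c A where "finite I" "\<And>k. A k \<in> sets \<mu>"
    "\<And>y. y \<in> \<Lambda> \<Longrightarrow> \<bar>f y - (\<Sum>k\<in>I. c k * indicator (A k) y)\<bar> \<le> e"
proof -
  note [measurable] = measurable_continuous[OF assms(1)]
  obtain B where B: "\<And>y. y \<in> \<Lambda> \<Longrightarrow> \<bar>f y\<bar> \<le> B" by (rule bounded_on_carrier[OF assms(1)]) blast
  define I where "I = {\<lfloor>- B / e\<rfloor>..\<lfloor>B / e\<rfloor>}"
  define A where "A k = {y \<in> space \<mu>. \<lfloor>f y / e\<rfloor> = k}" for k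
  have "\<bar>f y - (\<Sum>k\<in>I. e * of_int k * indicator (A k) y)\<bar> \<le> e" if y: "y \<in> \<Lambda>" for y
  proof -
    have "- B / e \<le> f y / e" "f y / e \<le> B / e"
      using B[OF y] assms(2) by (intro divide_right_mono; linarith)+
    then have k: "\<lfloor>f y / e\<rfloor> \<in> I" unfolding I_def by (auto intro: floor_mono)
    have "(\<Sum>k\<in>I. e * of_int k * indicator (A k) y) = (\<Sum>k\<in>I. if k = \<lfloor>f y / e\<rfloor> then e * of_int k else 0)"
      by (rule sum.cong) (use y in \<open>auto simp: A_def space_eq\<close>)
    also have "\<dots> = e * of_int \<lfloor>f y / e\<rfloor>"
      using k by (simp add: I_def)
    finally have s: "(\<Sum>k\<in>I. e * of_int k * indicator (A k) y) = e * of_int \<lfloor>f y / e\<rfloor>" .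
    have "e * of_int \<lfloor>f y / e\<rfloor> \<le> e * (f y / e)" "e * (f y / e) \<le> e * (of_int \<lfloor>f y / e\<rfloor> + 1)"
      using assms(2) by (intro mult_left_mono; linarith)+
    then show ?thesis using assms(2) unfolding s by (simp add: distrib_left)
  qed
  moreover have "A k \<in> sets \<mu>" for k unfolding A_def by measurable
  ultimately show ?thesis using that[of I A "\<lambda>k. e * of_int k"] by (auto simp: I_def)
qed

lemma mixing_simple:
  fixes c d :: "'k \<Rightarrow> real"
  assumes "finite I" "finite J" and A: "\<And>k. A k \<in> sets \<mu>" and B: "\<And>k. B k \<in> sets \<mu>"
  defines "s \<equiv> \<lambda>y. \<Sum>k\<in>I. c k * indicator (A k) y" and "s' \<equiv> \<lambda>y. \<Sum>l\<in>J. d l * indicator (B l) y"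
  shows "(correlation s s' \<longlongrightarrow> integral\<^sup>L \<mu> s * integral\<^sup>L \<mu> s') at_top"
proof -
  have im: "integral\<^sup>L \<mu> (\<lambda>y. \<Sum>k\<in>I. c k * indicator (A k) y) = (\<Sum>k\<in>I. c k * measure \<mu> (A k))"
    if "\<And>k. A k \<in> sets \<mu>" for I c and A :: "'k \<Rightarrow> _"
    using that sets.sets_into_space
    by (subst Bochner_Integration.integral_sum) (auto simp: Int_absorb2 emeasure_eq_measure)
  define C where "C t k l = \<phi> t -` B l \<inter> space \<mu> \<inter> A k" for t k l
  have C: "C t k l \<in> sets \<mu>" for t k l
    unfolding C_def using A B measurable_sets[OF flow_measurable] by blast
  have "correlation s s' = (\<lambda>t. \<Sum>k\<in>I. \<Sum>l\<in>J. (c k * d l) * measure \<mu> (C t k l))"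
  proof
    fix t
    have "correlation s s' t = (\<integral>y. (\<Sum>k\<in>I. \<Sum>l\<in>J. (c k * d l) * indicator (C t k l) y) \<partial>\<mu>)"
      unfolding correlation_def
    proof (rule Bochner_Integration.integral_cong[OF refl])
      fix y assume "y \<in> space \<mu>"
      then have "indicator (A k) y * indicator (B l) (\<phi> t y) = (indicator (C t k l) y :: real)" for k l
        by (auto simp: C_def indicator_def)
      then show "s y * s' (\<phi> t y) = (\<Sum>k\<in>I. \<Sum>l\<in>J. (c k * d l) * indicator (C t k l) y)"
        unfolding s_def s'_def sum_product by (simp add: algebra_simps)
    qed
    also have "\<dots> = (\<Sum>k\<in>I. (\<integral>y. (\<Sum>l\<in>J. (c k * d l) * indicator (C t k l) y) \<partial>\<mu>))"
      using C by (intro Bochner_Integration.integral_sum Bochner_Integration.integrable_sum)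
        (auto simp: emeasure_eq_measure)
    also have "\<dots> = (\<Sum>k\<in>I. \<Sum>l\<in>J. (c k * d l) * measure \<mu> (C t k l))"
      using C sets.sets_into_space
      by (intro sum.cong refl, subst Bochner_Integration.integral_sum) (auto simp: Int_absorb2 emeasure_eq_measure)
    finally show "correlation s s' t = (\<Sum>k\<in>I. \<Sum>l\<in>J. (c k * d l) * measure \<mu> (C t k l))" .
  qed
  moreover have "((\<lambda>t. \<Sum>k\<in>I. \<Sum>l\<in>J. (c k * d l) * measure \<mu> (C t k l)) \<longlongrightarrow>
      (\<Sum>k\<in>I. \<Sum>l\<in>J. (c k * d l) * (measure \<mu> (B l) * measure \<mu> (A k)))) at_top"
    using mix A B unfolding flow_mixing_def C_def by (intro tendsto_intros) blast
  moreover have "(\<Sum>k\<in>I. \<Sum>l\<in>J. (c k * d l) * (measure \<mu> (B l) * measure \<mu> (A k)))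
      = integral\<^sup>L \<mu> s * integral\<^sup>L \<mu> s'"
    unfolding s_def s'_def im[OF A] im[OF B] sum_product by (simp add: algebra_simps)
  ultimately show ?thesis by simp
qed

text \<open>Both functions are replaced by uniformly close simple functions. The error in the
  correlation is then bounded uniformly in t, so the limit for simple functions carries
  over.\<close>

lemma mixing_continuous:
  assumes u: "continuous_on UNIV u" and f: "continuous_on UNIV f"
  shows "(correlation u f \<longlongrightarrow> integral\<^sup>L \<mu> u * integral\<^sup>L \<mu> f) at_top"
proof (rule tendstoI)
  fix e :: real assume e: "e > 0"
  obtain U where U: "U \<ge> 0" "\<And>y. y \<in> \<Lambda> \<Longrightarrow> \<bar>u y\<bar> \<le> U" by (rule bounded_on_carrier[OF u]) blast
  obtain F where F: "F \<ge> 0" "\<And>y. y \<in> \<Lambda> \<Longrightarrow> \<bar>f y\<bar> \<le> F" by (rule bounded_on_carrier[OF f]) blast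
  \<comment> \<open>K bounds u and f as well as their simple approximants, since a is at most 1.
    Replacing both factors costs at most 2aK, which is at most e/4; this is paid once for the
    correlation and once for the product of the means, leaving e/2 for the convergence of the simple
    correlation.\<close>
  define K where "K = U + F + 1"
  define a where "a = min 1 (e / (8 * K))"
  have K: "K \<ge> 1" using U F by (simp add: K_def)
  have a: "a > 0" "a \<le> 1" "a * K \<le> e / 8" using e K by (auto simp: a_def min_def field_simps)
  obtain I :: "int set" and c A where I: "finite I" "\<And>k. A k \<in> sets \<mu>"
    "\<And>y. y \<in> \<Lambda> \<Longrightarrow> \<bar>u y - (\<Sum>k\<in>I. c k * indicator (A k) y)\<bar> \<le> a"
    by (rule uniform_simple_approximation[OF u a(1)]) blast
  obtain J :: "int set" and d B where J: "finite J" "\<And>k. B k \<in> sets \<mu>"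
    "\<And>y. y \<in> \<Lambda> \<Longrightarrow> \<bar>f y - (\<Sum>k\<in>J. d k * indicator (B k) y)\<bar> \<le> a"
    by (rule uniform_simple_approximation[OF f a(1)]) blast
  define s where "s = (\<lambda>y. \<Sum>k\<in>I. c k * indicator (A k) y)"
  define s' where "s' = (\<lambda>y. \<Sum>l\<in>J. d l * indicator (B l) y)"
  have [measurable]: "s \<in> borel_measurable \<mu>" "s' \<in> borel_measurable \<mu>"
    unfolding s_def s'_def using I J by measurable
  have su: "\<bar>u y - s y\<bar> \<le> a" "\<bar>f y - s' y\<bar> \<le> a" if "y \<in> \<Lambda>" for y
    using I(3) J(3) that by (auto simp: s_def s'_def)
  have sK: "\<bar>s y\<bar> \<le> K" "\<bar>s' y\<bar> \<le> K" "\<bar>u y\<bar> \<le> K" if "y \<in> \<Lambda>" for y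
    using su[OF that] U F a that[THEN U(2)] that[THEN F(2)] by (auto simp: K_def)
  have prod: "\<bar>x * z - x' * z'\<bar> \<le> 2 * (a * K)"
    if "\<bar>x - x'\<bar> \<le> a" "\<bar>z - z'\<bar> \<le> a" "\<bar>x\<bar> \<le> K" "\<bar>z'\<bar> \<le> K" for x x' z z'
  proof -
    have "x * z - x' * z' = (z - z') * x + (x - x') * z'" by algebra
    moreover have "\<bar>(z - z') * x\<bar> \<le> a * K" "\<bar>(x - x') * z'\<bar> \<le> a * K"
      unfolding abs_mult using that a by (auto intro!: mult_mono)
    ultimately show ?thesis by linarith
  qed
  have ints: "integrable \<mu> s" "integrable \<mu> s'"
    using sK by (auto intro!: integrable_bounded)
  have bound: "\<bar>integral\<^sup>L \<mu> h\<bar> \<le> b" if "integrable \<mu> h" "\<And>y. y \<in> \<Lambda> \<Longrightarrow> \<bar>h y\<bar> \<le> b" for h :: "real^'m \<Rightarrow> real" and b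
  proof -
    have "h y \<le> b" "- b \<le> h y" if "y \<in> space \<mu>" for y
      using \<open>\<And>y. y \<in> \<Lambda> \<Longrightarrow> \<bar>h y\<bar> \<le> b\<close>[of y] that by (auto simp: space_eq)
    then have ae: "AE y in \<mu>. h y \<le> b" "AE y in \<mu>. - b \<le> h y" by auto
    have "integral\<^sup>L \<mu> h \<le> b" "- b \<le> integral\<^sup>L \<mu> h"
      by (rule integral_le_const[OF that(1) ae(1)], rule integral_ge_const[OF that(1) ae(2)])
    then show ?thesis by linarith
  qed
  note iu = integrable_cont[OF u] and jf = integrable_cont[OF f]
  have d0: "\<bar>integral\<^sup>L \<mu> u * integral\<^sup>L \<mu> f - integral\<^sup>L \<mu> s * integral\<^sup>L \<mu> s'\<bar> \<le> 2 * (a * K)"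
  proof (rule prod)
    show "\<bar>integral\<^sup>L \<mu> u - integral\<^sup>L \<mu> s\<bar> \<le> a"
      using bound[of "\<lambda>y. u y - s y" a] iu ints su by simp
    show "\<bar>integral\<^sup>L \<mu> f - integral\<^sup>L \<mu> s'\<bar> \<le> a"
      using bound[of "\<lambda>y. f y - s' y" a] jf ints su by simp
  qed (use bound[OF iu] bound[OF ints(2)] sK in auto)
  have d: "\<bar>correlation u f t - correlation s s' t\<bar> \<le> 2 * (a * K)" for t
  proof -
    have m: "(\<lambda>y. s' (\<phi> t y)) \<in> borel_measurable \<mu>" by measurable
    have i: "integrable \<mu> (\<lambda>y. s y * s' (\<phi> t y))"
      using sK flow_in K m
      by (intro integrable_bounded[of _ "K * K"]) (auto simp: abs_mult intro!: mult_mono)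
    have "correlation u f t - correlation s s' t = (\<integral>y. u y * f (\<phi> t y) - s y * s' (\<phi> t y) \<partial>\<mu>)"
      unfolding correlation_def
      by (rule Bochner_Integration.integral_diff[symmetric, OF integrable_correlation[OF u f] i])
    moreover have "\<bar>\<dots>\<bar> \<le> 2 * (a * K)"
      by (rule bound[OF Bochner_Integration.integrable_diff[OF integrable_correlation[OF u f] i]])
        (intro prod su sK flow_in)
    ultimately show ?thesis by simp
  qed
  have "\<forall>\<^sub>F t in at_top. dist (correlation s s' t) (integral\<^sup>L \<mu> s * integral\<^sup>L \<mu> s') < e / 2"
    by (rule tendstoD) (use mixing_simple[OF I(1) J(1) I(2) J(2)] a e in \<open>auto simp: s_def s'_def\<close>)
  then show "\<forall>\<^sub>F t in at_top. dist (correlation u f t) (integral\<^sup>L \<mu> u * integral\<^sup>L \<mu> f) < e"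
  proof eventually_elim
    case (elim t)
    then show ?case
      using d[of t] d0 a(3) unfolding dist_real_def by linarith
  qed
qed

text \<open>In the formula for finite T the term at time T tends to the product of the means, which
  is 0 because f has mean zero.\<close>

lemma integral_correlation_lie_tendsto:
  assumes u: "continuous_on UNIV u" and f: "Ck (Suc 0) f" and m: "integral\<^sup>L \<mu> f = 0"
  shows "((\<lambda>T. integral {0..T} (correlation u (lie g f))) \<longlongrightarrow> - (\<integral>y. u y * f y \<partial>\<mu>)) at_top"
proof -
  have "((\<lambda>T. correlation u f T - (\<integral>y. u y * f y \<partial>\<mu>)) \<longlongrightarrow> 0 - (\<integral>y. u y * f y \<partial>\<mu>)) at_top"
    using mixing_continuous[OF u Ck_imp_continuous[OF f]] m by (intro tendsto_intros) simp
  moreover have "\<forall>\<^sub>F T in at_top. correlation u f T - (\<integral>y. u y * f y \<partial>\<mu>) = integral {0..T} (correlation u (lie g f))"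
    using eventually_ge_at_top[of 0]
    by eventually_elim (simp add: integral_correlation_lie[OF u f])
  ultimately show ?thesis by (simp add: tendsto_cong)
qed

section \<open>Even functions with infinitely many values\<close>

text \<open>For almost every y the values of q along the orbit lie in F at all rational times, a
  countable intersection of full-measure conditions, and hence at all times by continuity and
  closedness of F. A continuous function on the line with finite range is constant, so the level
  sets of q are invariant up to null sets and mixing leaves just one of them with positive
  measure.\<close>

lemma finite_valued_imp_constant:
  fixes q :: "real^'m \<Rightarrow> real"
  assumes q: "continuous_on UNIV q" and F: "finite F" "AE y in \<mu>. q y \<in> F"
  shows "\<exists>a. AE y in \<mu>. q y = a"
proof -
  note [measurable] = measurable_continuous[OF q]
  have in_F: "AE y in \<mu>. q (\<phi> s y) \<in> F" for s
  proof -
    have "AE y in distr \<mu> \<mu> (\<phi> s). q y \<in> F" using F(2) unfolding flow_distr .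
    then show ?thesis by (rule AE_distrD[OF flow_measurable])
  qed
  then have rat: "AE y in \<mu>. \<forall>s\<in>\<rat>. q (\<phi> s y) \<in> F"
    by (simp add: AE_ball_countable countable_rat)
  have const: "q (\<phi> t y) = q y" if y: "y \<in> \<Lambda>" and *: "\<forall>s\<in>\<rat>. q (\<phi> s y) \<in> F" for t y
  proof -
    have c: "continuous_on UNIV (\<lambda>s. q (\<phi> s y))"
      using continuous_on_compose2[OF q flow_continuous[OF y]] by simp
    then have cl: "closed ((\<lambda>s. q (\<phi> s y)) -` F)"
      using F(1) by (intro closed_vimage) (auto simp: finite_imp_closed)
    have "\<rat> \<subseteq> (\<lambda>s. q (\<phi> s y)) -` F" using * by auto
    then have "closure \<rat> \<subseteq> (\<lambda>s. q (\<phi> s y)) -` F" using cl closure_minimal by blast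
    then have "range (\<lambda>s. q (\<phi> s y)) \<subseteq> F" using Rats_closure_real by auto
    then have "(\<lambda>s. q (\<phi> s y)) constant_on UNIV"
      using c F(1) finite_subset by (intro continuous_finite_range_constant) auto
    then have "q (\<phi> t y) = q (\<phi> 0 y)" by (auto simp: constant_on_def)
    then show ?thesis using flow_0[OF y] by simp
  qed
  have inv: "AE y in \<mu>. \<forall>t. q (\<phi> t y) = q y"
    using rat AE_space[of \<mu>] by eventually_elim (use const space_eq in blast)
  define A where "A a = {y \<in> space \<mu>. q y = a}" for a
  have A [measurable]: "A a \<in> sets \<mu>" for a unfolding A_def by measurable
  \<comment> \<open>Mixing of \<open>A a\<close> with itself: the measure of the intersection is
    constant in t by almost sure invariance, so the measure of \<open>A a\<close> equals its own
    square.\<close>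
  have "measure \<mu> (A a) = 0 \<or> measure \<mu> (A a) = 1" for a
  proof -
    have "measure \<mu> (\<phi> t -` A a \<inter> space \<mu> \<inter> A a) = measure \<mu> (A a)" for t
    proof (rule finite_measure_eq_AE)
      show "AE y in \<mu>. (y \<in> \<phi> t -` A a \<inter> space \<mu> \<inter> A a) = (y \<in> A a)"
        using inv by eventually_elim (use flow_in in \<open>auto simp: A_def space_eq\<close>)
    qed measurable
    moreover have "((\<lambda>t. measure \<mu> (\<phi> t -` A a \<inter> space \<mu> \<inter> A a)) \<longlongrightarrow> measure \<mu> (A a) * measure \<mu> (A a)) at_top"
      using mix A unfolding flow_mixing_def by blast
    ultimately have "measure \<mu> (A a) * measure \<mu> (A a) = measure \<mu> (A a)"
      by (simp add: tendsto_const_iff)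
    then show ?thesis by simp
  qed
  moreover have "\<exists>a. measure \<mu> (A a) \<noteq> 0"
  proof (rule ccontr)
    assume "\<not> ?thesis"
    then have "AE y in \<mu>. y \<notin> A a" for a
      using prob_eq_0[OF A] by blast
    then have "AE y in \<mu>. \<forall>a\<in>F. y \<notin> A a"
      using F(1) by (simp add: AE_finite_all)
    then have "AE y in \<mu>. False"
      using F(2) AE_space[of \<mu>] by eventually_elim (auto simp: A_def)
    then show False by simp
  qed
  ultimately obtain a where "measure \<mu> (A a) = 1" by blast
  then have "AE y in \<mu>. y \<in> A a" using prob_eq_1[OF A] by blast
  then have "AE y in \<mu>. q y = a" by eventually_elim (simp add: A_def)
  then show ?thesis by blast
qed

text \<open>
  Otherwise x + R x and the squares of the coordinates of x - R x take finitely many values almost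
  everywhere; then so do the coordinates, which are thus almost everywhere constant.
\<close>
lemma ex_infinite_valued_even:
  assumes nd: "\<not> is_dirac \<mu>" and R2: "R ** R = mat 1"
  shows "\<exists>P. (\<forall>k. Ck k P) \<and> (\<forall>x. P (R *v x) = P x) \<and> (\<forall>F. finite F \<longrightarrow> \<not> (AE y in \<mu>. P y \<in> (F :: real set)))"
proof (rule ccontr)
  assume *: "\<not> ?thesis"
  have RR: "R *v (R *v x) = x" for x :: "real^'m"
    by (simp add: matrix_vector_mul_assoc R2)
  have lin: "Ck k (\<lambda>x. x $ i)" "Ck k (\<lambda>x. (R *v x) $ i)" for k and i :: 'm
    by (intro Ck_linear bounded_linear_compose[OF bounded_linear_vec_nth matrix_vector_mul_bounded_linear]
        bounded_linear_vec_nth)+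
  have "\<exists>a. AE y in \<mu>. y $ i = a" for i
  proof -
    let ?P = "\<lambda>x. x $ i + (R *v x) $ i" and ?Q = "\<lambda>x. (x $ i + (-1) *\<^sub>R (R *v x) $ i) * (x $ i + (-1) *\<^sub>R (R *v x) $ i)"
    have "(\<forall>k. Ck k ?P) \<and> (\<forall>x. ?P (R *v x) = ?P x)"
      by (auto intro!: Ck_add lin simp: RR)
    then obtain F where F: "finite F" "AE y in \<mu>. ?P y \<in> F" using * by blast
    have "(\<forall>k. Ck k ?Q) \<and> (\<forall>x. ?Q (R *v x) = ?Q x)"
      by (intro conjI allI Ck_mult Ck_add Ck_scaleR lin) (simp add: RR algebra_simps)
    then obtain G where G: "finite G" "AE y in \<mu>. ?Q y \<in> G" using * by blast
    \<comment> \<open>The square root of \<open>?Q y\<close> is the absolute value of the difference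
      of the i-th coordinates of y and Ry, so the i-th coordinate of y is recovered up to the lost
      sign. Both signs are included.\<close>
    let ?H = "(\<lambda>(p, z). (p + sqrt z) / 2) ` (F \<times> G) \<union> (\<lambda>(p, z). (p - sqrt z) / 2) ` (F \<times> G)"
    have "AE y in \<mu>. y $ i \<in> ?H"
      using F(2) G(2)
    proof eventually_elim
      fix y assume y: "?P y \<in> F" "?Q y \<in> G"
      have "sqrt (?Q y) = \<bar>y $ i - (R *v y) $ i\<bar>" by simp
      then have "y $ i = (?P y + sqrt (?Q y)) / 2 \<or> y $ i = (?P y - sqrt (?Q y)) / 2"
        by (simp add: abs_if field_simps split: if_splits)
      then show "y $ i \<in> ?H" using y by force
    qed
    moreover have "finite ?H" using F(1) G(1) by auto
    ultimately show ?thesis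
      using finite_valued_imp_constant[of "\<lambda>y. y $ i" ?H] Ck_imp_continuous[OF lin(1)] by blast
  qed
  then obtain a where "\<And>i. AE y in \<mu>. y $ i = a i" by metis
  then have "AE y in \<mu>. \<forall>i\<in>UNIV. y $ i = a i" by (subst AE_finite_all) auto
  then have ae: "AE y in \<mu>. y = (\<chi> i. a i)"
    by eventually_elim (simp add: vec_eq_iff)
  define b where "b = (\<chi> i. a i)"
  have "is_dirac \<mu>" unfolding is_dirac_def
  proof (intro bexI ballI)
    show "b \<in> space \<mu>"
    proof (rule ccontr)
      assume b: "b \<notin> space \<mu>"
      have "AE y in \<mu>. False"
        using ae AE_space[of \<mu>] by eventually_elim (use b in \<open>auto simp: b_def\<close>)
      then show False by simp
    qed
    fix A assume A: "A \<in> sets \<mu>"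
    show "emeasure \<mu> A = indicator A b"
    proof (cases "b \<in> A")
      case True
      have "AE y in \<mu>. y \<in> A" using ae by eventually_elim (use True b_def in simp)
      then show ?thesis using True A emeasure_eq_1_AE by auto
    next
      case False
      have "AE y in \<mu>. y \<notin> A" using ae by eventually_elim (use False b_def in simp)
      then show ?thesis using False A prob_eq_0[OF A] by (simp add: emeasure_eq_measure)
    qed
  qed
  with nd show False by blast
qed

section \<open>Linearity of the time-integrated correlation\<close>

text \<open>A relation rather than a function, so that convergence of the improper integral and its
  value are carried together through linear combinations.\<close>

definition correlates :: "(real^'m \<Rightarrow> real) \<Rightarrow> (real^'m \<Rightarrow> real) \<Rightarrow> real \<Rightarrow> bool" where
  "correlates f h L \<longleftrightarrow> ((\<lambda>T. integral {0..T} (correlation f h)) \<longlongrightarrow> L) at_top"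

lemma correlates_unique: "correlates f h L \<Longrightarrow> correlates f h M \<Longrightarrow> L = M"
  unfolding correlates_def by (rule tendsto_unique[OF trivial_limit_at_top_linorder])

lemma correlates_add_left:
  assumes "continuous_on UNIV f" "continuous_on UNIV f'" "continuous_on UNIV h"
    and "correlates f h L" "correlates f' h L'"
  shows "correlates (\<lambda>y. f y + f' y) h (L + L')"
proof -
  have "correlation (\<lambda>y. f y + f' y) h = (\<lambda>t. correlation f h t + correlation f' h t)"
    unfolding correlation_def[abs_def]
    by (subst Bochner_Integration.integral_add[symmetric, OF integrable_correlation[OF assms(1,3)]
          integrable_correlation[OF assms(2,3)]]) (simp add: distrib_right)
  then have "integral {0..T} (correlation (\<lambda>y. f y + f' y) h)
      = integral {0..T} (correlation f h) + integral {0..T} (correlation f' h)" for T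
    using Henstock_Kurzweil_Integration.integral_add[OF correlation_integrable[OF assms(1,3)]
        correlation_integrable[OF assms(2,3)], of 0 T] by simp
  then show ?thesis
    using tendsto_add[OF assms(4,5)[unfolded correlates_def]] by (simp add: correlates_def)
qed

lemma correlates_add_right:
  assumes "continuous_on UNIV f" "continuous_on UNIV h" "continuous_on UNIV h'"
    and "correlates f h L" "correlates f h' L'"
  shows "correlates f (\<lambda>y. h y + h' y) (L + L')"
proof -
  have "correlation f (\<lambda>y. h y + h' y) = (\<lambda>t. correlation f h t + correlation f h' t)"
    unfolding correlation_def[abs_def]
    by (subst Bochner_Integration.integral_add[symmetric, OF integrable_correlation[OF assms(1,2)]
          integrable_correlation[OF assms(1,3)]]) (simp add: distrib_left)
  then have "integral {0..T} (correlation f (\<lambda>y. h y + h' y))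
      = integral {0..T} (correlation f h) + integral {0..T} (correlation f h')" for T
    using Henstock_Kurzweil_Integration.integral_add[OF correlation_integrable[OF assms(1,2)]
        correlation_integrable[OF assms(1,3)], of 0 T] by simp
  then show ?thesis
    using tendsto_add[OF assms(4,5)[unfolded correlates_def]] by (simp add: correlates_def)
qed

lemma correlates_cmult_left: "correlates f h L \<Longrightarrow> correlates (\<lambda>y. a * f y) h (a * L)"
  unfolding correlates_def
  by (drule tendsto_mult_left[of _ _ _ a]) (simp add: correlation_def[abs_def] mult.assoc)

lemma correlates_cmult_right:
  assumes "correlates f h L"
  shows "correlates f (\<lambda>y. a * h y) (a * L)"
proof -
  have "correlation f (\<lambda>y. a * h y) = (\<lambda>t. a * correlation f h t)"
    by (simp add: correlation_def[abs_def] mult.left_commute)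
  then show ?thesis
    using tendsto_mult_left[OF assms[unfolded correlates_def], of a] by (simp add: correlates_def)
qed

lemma correlates_zero_right: "correlates f (\<lambda>y. 0) 0"
  by (simp add: correlates_def correlation_def[abs_def])

lemma correlates_sum_right:
  assumes "continuous_on UNIV f" "\<And>i. i \<in> I \<Longrightarrow> continuous_on UNIV (h i)"
    and "\<And>i. i \<in> I \<Longrightarrow> correlates f (h i) (L i)"
  shows "correlates f (\<lambda>y. \<Sum>i\<in>I. h i y) (\<Sum>i\<in>I. L i)"
  using assms(2,3)
  by (induction I rule: infinite_finite_induct)
    (auto intro!: correlates_zero_right correlates_add_right assms(1) continuous_on_sum)

lemma correlates_lie:
  assumes "continuous_on UNIV u" "Ck (Suc 0) f" "integral\<^sup>L \<mu> f = 0"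
  shows "correlates u (lie g f) (- (\<integral>y. u y * f y \<partial>\<mu>))"
  using integral_correlation_lie_tendsto[OF assms] by (simp add: correlates_def)

text \<open>The functions are polynomials in a single even P with infinitely many values. The
  conditions other than smoothness, evenness and mean zero serve the expansion of the correlations
  of the perturbed function: two kinds of cross terms vanish, and orthonormality isolates a single
  coefficient in the remaining one.\<close>

lemma ex_orthonormal_frame:
  fixes up :: "'p::finite \<Rightarrow> real^'m \<Rightarrow> real" and um :: "'q::finite \<Rightarrow> real^'m \<Rightarrow> real"
  assumes nd: "\<not> is_dirac \<mu>" and R2: "R ** R = mat 1"
    and up: "\<And>i. continuous_on UNIV (up i)" and um: "\<And>j. continuous_on UNIV (um j)"
    and lim: "\<And>f j. (\<And>k. Ck k f) \<Longrightarrow> (\<And>x. f (R *v x) = f x) \<Longrightarrow> integral\<^sup>L \<mu> f = 0 \<Longrightarrow>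
        \<exists>L. correlates f (um j) L"
  shows "\<exists>f :: 'p \<Rightarrow> real^'m \<Rightarrow> real. (\<forall>i k. Ck k (f i)) \<and> (\<forall>i x. f i (R *v x) = f i x) \<and>
    (\<forall>i. integral\<^sup>L \<mu> (f i) = 0) \<and> (\<forall>i j. (\<integral>y. up i y * f j y \<partial>\<mu>) = 0) \<and>
    (\<forall>i j. (\<integral>y. f i y * f j y \<partial>\<mu>) = (if i = j then 1 else 0)) \<and>
    (\<forall>i j. correlates (f i) (um j) 0)"
proof -
  obtain P :: "real^'m \<Rightarrow> real" where P: "\<And>k. Ck k P" "\<And>x. P (R *v x) = P x"
    "\<And>F. finite F \<Longrightarrow> \<not> (AE y in \<mu>. P y \<in> F)"
    using ex_infinite_valued_even[OF nd R2] by blast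
  define F where "F c = (\<lambda>y. poly c (P y))" for c
  have F: "Ck k (F c)" for k c unfolding F_def by (intro Ck_poly P)
  have cF: "continuous_on UNIV (F c)" for c using Ck_imp_continuous[OF F] .
  have F_even: "F c (R *v x) = F c x" for c x by (simp add: F_def P)
  have F_add: "F (p + q) = (\<lambda>y. F p y + F q y)" and F_smult: "F (smult a p) = (\<lambda>y. a * F p y)" for p q a
    by (auto simp: F_def)
  define m where "m c = integral\<^sup>L \<mu> (F c)" for c
  have m_add: "m (p + q) = m p + m q" for p q
    unfolding m_def F_add by (rule Bochner_Integration.integral_add) (intro integrable_cont cF)+
  have m_smult: "m (smult a p) = a * m p" for a p
    unfolding m_def F_smult by simp
  \<comment> \<open>The limits in \<open>lim\<close> are available for mean-zero functions only, so
    the correlation functionals are first defined on the centred functions \<open>G c\<close>. Once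
    the mean of \<open>F c\<close> is annihilated, \<open>G c\<close> and \<open>F c\<close>
    coincide.\<close>
  define G where "G c = (\<lambda>y. F c y + - m c)" for c
  have G: "Ck k (G c)" for k c unfolding G_def by (intro Ck_add F Ck_const)
  have cG: "continuous_on UNIV (G c)" for c using Ck_imp_continuous[OF G] .
  have "integral\<^sup>L \<mu> (G c) = 0" for c
    unfolding G_def
    by (subst Bochner_Integration.integral_add) (auto intro: integrable_cont cF simp: m_def prob_space)
  then have "\<exists>L. correlates (G c) (um j) L" for c j
    by (intro lim G) (auto simp: G_def F_even)
  then obtain B where B: "correlates (G c) (um j) (B c j)" for c j by metis
  have G_add: "G (p + q) = (\<lambda>y. G p y + G q y)" and G_smult: "G (smult a p) = (\<lambda>y. a * G p y)" for p q a
    by (auto simp: G_def F_add F_smult m_add m_smult algebra_simps)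
  \<comment> \<open>\<open>B\<close> was obtained by choice, one limit per polynomial and
    coordinate. Uniqueness of limits makes it linear in the polynomial.\<close>
  have B_add: "B (p + q) j = B p j + B q j" for j p q
    using correlates_unique[OF B[of "p + q" j]] correlates_add_left[OF cG cG um B B, of p q j] G_add by simp
  have B_smult: "B (smult a p) j = a * B p j" for j a p
    using correlates_unique[OF B[of "smult a p" j]] correlates_cmult_left[OF B, of a p j] G_smult by simp
  define Q where "Q p q = (\<integral>y. F p y * F q y \<partial>\<mu>)" for p q
  have int: "integrable \<mu> (\<lambda>y. f y * h y)" if "continuous_on UNIV f" "continuous_on UNIV h" for f h :: "real^'m \<Rightarrow> real"
    by (intro integrable_cont continuous_on_mult that)
  have inner_add: "(\<integral>y. f y * F (p + q) y \<partial>\<mu>) = (\<integral>y. f y * F p y \<partial>\<mu>) + (\<integral>y. f y * F q y \<partial>\<mu>)"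
    if "continuous_on UNIV f" for f p q
    unfolding F_add distrib_left by (rule Bochner_Integration.integral_add; intro int that cF)
  have inner_smult: "(\<integral>y. f y * F (smult a p) y \<partial>\<mu>) = a * (\<integral>y. f y * F p y \<partial>\<mu>)" for f a p
    unfolding F_smult mult.left_commute[of _ a] by simp
  \<comment> \<open>If the norm vanished, P would almost surely take values in the finite root set
    of p, contrary to the choice of P.\<close>
  have Q_pos: "Q p p > 0" if "p \<noteq> 0" for p
  proof (rule ccontr)
    assume "\<not> 0 < Q p p"
    moreover have "0 \<le> Q p p" unfolding Q_def by (rule Bochner_Integration.integral_nonneg) simp
    ultimately have "Q p p = 0" by simp
    then have "AE y in \<mu>. F p y * F p y = 0"
      unfolding Q_def by (subst (asm) integral_nonneg_eq_0_iff_AE) (auto intro: int cF)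
    then have "AE y in \<mu>. P y \<in> {z. poly p z = 0}"
      by eventually_elim (simp add: F_def)
    then show False using P(3) poly_roots_finite[OF that] by blast
  qed
  \<comment> \<open>One functional for the mean, one for each even coordinate \<open>up i\<close>,
    and one for each odd coordinate \<open>um j\<close>: a finite family.\<close>
  define l where "l = case_sum (\<lambda>_::unit. m) (case_sum (\<lambda>i p. (\<integral>y. up i y * F p y \<partial>\<mu>)) (\<lambda>j p. B p j))"
  have "\<exists>c :: 'p \<Rightarrow> real poly. (\<forall>s\<in>UNIV. \<forall>i\<in>UNIV. l i (c s) = 0) \<and>
      (\<forall>s\<in>UNIV. \<forall>t\<in>UNIV. Q (c s) (c t) = (if s = t then 1 else 0))"
  proof (rule ex_orthonormal_poly_annihilated)
    show "l i (p + q) = l i p + l i q" for i p q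
      by (auto simp: l_def m_add B_add inner_add up split: sum.split)
    show "l i (smult a p) = a * l i p" for i a p
      by (auto simp: l_def m_smult B_smult inner_smult split: sum.split)
    show "Q r (p + q) = Q r p + Q r q" for r p q
      unfolding Q_def by (rule inner_add[OF cF])
    show "Q r (smult a p) = a * Q r p" for a p r
      unfolding Q_def by (rule inner_smult)
    show "Q p q = Q q p" for p q
      unfolding Q_def by (simp add: mult.commute)
  qed (use Q_pos in auto)
  then obtain c :: "'p \<Rightarrow> real poly" where l0: "\<And>s i. l i (c s) = 0"
    and c: "\<And>s t. Q (c s) (c t) = (if s = t then 1 else 0)" by auto
  have m0: "m (c s) = 0" for s using l0[of "Inl ()" s] by (simp add: l_def)
  have up0: "(\<integral>y. up i y * F (c s) y \<partial>\<mu>) = 0" for i s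
    using l0[of "Inr (Inl i)" s] by (simp add: l_def)
  have "G (c s) = F (c s)" for s by (simp add: G_def m0)
  then have B0: "correlates (F (c s)) (um j) 0" for s j
    using l0[of "Inr (Inr j)" s] B[of "c s" j] by (simp add: l_def)
  show ?thesis
    by (intro exI[of _ "\<lambda>s. F (c s)"] conjI allI)
      (rule F F_even m0[unfolded m_def] up0 c[unfolded Q_def] B0)+
qed

section \<open>Vector-valued functions, admissibility and chi in coordinates\<close>

lemma integrable_vec:
  fixes v :: "real^'m \<Rightarrow> real^'n::finite"
  assumes "continuous_on UNIV v"
  shows "integrable \<mu> v"
proof -
  have "integrable \<mu> (\<lambda>x. \<Sum>k\<in>UNIV. v x $ k *\<^sub>R axis k (1::real))"
    using assms
    by (intro Bochner_Integration.integrable_sum integrable_scaleR_left integrable_cont continuous_on_component)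
  then show ?thesis
    by (simp add: basis_expansion scalar_mult_eq_scaleR[symmetric])
qed

lemma integral_vec_nth:
  fixes v :: "real^'m \<Rightarrow> real^'n::finite"
  assumes "continuous_on UNIV v"
  shows "integral\<^sup>L \<mu> v $ k = (\<integral>x. v x $ k \<partial>\<mu>)"
  using integral_bounded_linear[OF bounded_linear_vec_nth integrable_vec[OF assms], of k] by simp

text \<open>The substitution y to Ry preserves \<mu> and reverses the sign of the integrand on
  \<Lambda>, so the integral equals its negative.\<close>

lemma integral_odd:
  fixes h :: "real^'m \<Rightarrow> real"
  assumes Rinv: "distr \<mu> \<mu> ((*v) R) = \<mu>" and R: "(*v) R ` \<Lambda> = \<Lambda>"
    and h: "continuous_on UNIV h" "\<And>y. y \<in> \<Lambda> \<Longrightarrow> h (R *v y) = - h y"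
  shows "integral\<^sup>L \<mu> h = 0"
proof -
  have "(*v) R \<in> measurable (restrict_space borel \<Lambda>) (restrict_space borel \<Lambda>)"
    using R by (intro measurable_restrict_space3 borel_measurable_continuous_onI linear_continuous_on
        matrix_vector_mul_bounded_linear) auto
  then have "(*v) R \<in> measurable \<mu> \<mu>"
    using measurable_cong_sets[OF sets_eq sets_eq] by blast
  then have "integral\<^sup>L (distr \<mu> \<mu> ((*v) R)) h = (\<integral>y. h (R *v y) \<partial>\<mu>)"
    by (rule integral_distr) (rule measurable_continuous[OF h(1)])
  then have "integral\<^sup>L \<mu> h = (\<integral>y. h (R *v y) \<partial>\<mu>)" by (simp add: Rinv)
  also have "\<dots> = (\<integral>y. - h y \<partial>\<mu>)"
    by (rule Bochner_Integration.integral_cong) (auto simp: space_eq h)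
  finally show ?thesis by simp
qed

lemma admissibleD:
  assumes "admissible r R \<mu> v"
  shows "Ck r (\<lambda>x. v x $ k)" "integral\<^sup>L \<mu> (\<lambda>x. v x $ k) = 0"
    "y \<in> \<Lambda> \<Longrightarrow> v (R *v y) $ Inl i = v y $ Inl i" "y \<in> \<Lambda> \<Longrightarrow> v (R *v y) $ Inr j = - v y $ Inr j"
proof -
  have v: "Ck r v" "integral\<^sup>L \<mu> v = 0" "\<And>y. y \<in> \<Lambda> \<Longrightarrow> v (R *v y) = Amat *v v y"
    using assms by (auto simp: admissible_def space_eq)
  show "Ck r (\<lambda>x. v x $ k)" using v(1) by (rule Ck_nth)
  show "integral\<^sup>L \<mu> (\<lambda>x. v x $ k) = 0"
    using integral_vec_nth[OF Ck_imp_continuous[OF v(1)], of k] v(2) by simp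
qed (use assms in \<open>auto simp: admissible_def space_eq\<close>)

text \<open>Mean zero has to be supplied for the even coordinates only; the odd ones integrate to
  zero by \<open>integral_odd\<close>.\<close>

lemma admissibleI:
  assumes "distr \<mu> \<mu> ((*v) R) = \<mu>" "(*v) R ` \<Lambda> = \<Lambda>"
    and Ck: "\<And>k. Ck r (\<lambda>x. v x $ k)"
    and even: "\<And>y i. y \<in> \<Lambda> \<Longrightarrow> v (R *v y) $ Inl i = v y $ Inl i"
    and odd: "\<And>y j. y \<in> \<Lambda> \<Longrightarrow> v (R *v y) $ Inr j = - v y $ Inr j"
    and mean: "\<And>i. integral\<^sup>L \<mu> (\<lambda>x. v x $ Inl i) = 0"
  shows "admissible r R \<mu> v"
proof -
  have v: "Ck r v" using Ck by (rule Ck_vec)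
  have "integral\<^sup>L \<mu> v $ k = 0" for k
  proof (cases k)
    case (Inl i)
    then show ?thesis using mean integral_vec_nth[OF Ck_imp_continuous[OF v]] by simp
  next
    case (Inr j)
    then show ?thesis
      using integral_odd[OF assms(1,2) Ck_imp_continuous[OF Ck] odd] integral_vec_nth[OF Ck_imp_continuous[OF v]]
      by simp
  qed
  moreover have "v (R *v y) $ k = (Amat *v v y) $ k" if "y \<in> \<Lambda>" for y k
    using that even odd by (cases k) auto
  ultimately show ?thesis using v by (simp add: admissible_def space_eq vec_eq_iff)
qed

text \<open>Taking an entry has to commute with two integrals, the Bochner integral over \<mu> and
  the Henstock-Kurzweil integral over time. Expanding in the matrix basis
  \<open>axis i (axis j 1)\<close> turns both into finite sums of scalar integrals.\<close>

lemma integral_corr_nth: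
  fixes v :: "real^'m \<Rightarrow> real^('p::finite + 'q::finite)"
  assumes "continuous_on UNIV v"
  shows "integral {0..T} (corr \<mu> \<phi> v) $ i $ j
    = integral {0..T} (correlation (\<lambda>y. v y $ Inl i) (\<lambda>y. v y $ Inr j))"
proof -
  note c = continuous_on_component[OF assms]
  have e: "(\<Sum>i\<in>UNIV. \<Sum>j\<in>UNIV. M i j *\<^sub>R axis i (axis j (1::real))) = (\<chi> i j. M i j)" for M :: "'p \<Rightarrow> 'q \<Rightarrow> real"
  proof -
    have "(\<Sum>i\<in>UNIV. \<Sum>j\<in>UNIV. M i j *\<^sub>R axis i (axis j (1::real))) $ a $ b = M a b" for a b
    proof -
      have "M i j * axis i (axis j (1::real)) $ a $ b = (if j = b then if i = a then M i j else 0 else 0)" for i j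
        by (simp add: axis_def)
      then show ?thesis by simp
    qed
    then show ?thesis by (simp add: vec_eq_iff)
  qed
  have "corr \<mu> \<phi> v t = (\<Sum>i\<in>UNIV. \<Sum>j\<in>UNIV.
      correlation (\<lambda>y. v y $ Inl i) (\<lambda>y. v y $ Inr j) t *\<^sub>R axis i (axis j (1::real)))" for t
  proof -
    have o: "outer (vplus v y) (vminus v (\<phi> t y)) = (\<Sum>i\<in>UNIV. \<Sum>j\<in>UNIV.
        (v y $ Inl i * v (\<phi> t y) $ Inr j) *\<^sub>R axis i (axis j (1::real)))" for y
      unfolding e by (simp add: outer_def vplus_def vminus_def)
    have I: "integrable \<mu> (\<lambda>y. (v y $ Inl i * v (\<phi> t y) $ Inr j) *\<^sub>R axis i (axis j (1::real)))" for i j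
      by (rule integrable_scaleR_left, rule integrable_correlation[OF c c])
    have "corr \<mu> \<phi> v t = (\<Sum>i\<in>UNIV. \<Sum>j\<in>UNIV.
        (\<integral>y. (v y $ Inl i * v (\<phi> t y) $ Inr j) *\<^sub>R axis i (axis j (1::real)) \<partial>\<mu>))"
      unfolding corr_def o
      by (simp only: Bochner_Integration.integral_sum Bochner_Integration.integrable_sum I)
    then show ?thesis
      by (simp only: correlation_def integral_scaleR_left[OF integrable_correlation[OF c c]])
  qed
  then have "corr \<mu> \<phi> v = (\<lambda>t. \<Sum>i\<in>UNIV. \<Sum>j\<in>UNIV.
      correlation (\<lambda>y. v y $ Inl i) (\<lambda>y. v y $ Inr j) t *\<^sub>R axis i (axis j (1::real)))" by blast
  moreover have "((\<lambda>t. \<Sum>i\<in>UNIV. \<Sum>j\<in>UNIV.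
      correlation (\<lambda>y. v y $ Inl i) (\<lambda>y. v y $ Inr j) t *\<^sub>R axis i (axis j (1::real))) has_integral
      (\<Sum>i\<in>UNIV. \<Sum>j\<in>UNIV. integral {0..T} (correlation (\<lambda>y. v y $ Inl i) (\<lambda>y. v y $ Inr j)) *\<^sub>R axis i (axis j (1::real)))) {0..T}"
    by (intro has_integral_sum finite has_integral_scaleR_left integrable_integral correlation_integrable[OF c c])
  ultimately have "integral {0..T} (corr \<mu> \<phi> v) =
      (\<Sum>i\<in>UNIV. \<Sum>j\<in>UNIV. integral {0..T} (correlation (\<lambda>y. v y $ Inl i) (\<lambda>y. v y $ Inr j)) *\<^sub>R axis i (axis j (1::real)))"
    by (simp add: integral_unique)
  then show ?thesis unfolding e by simp
qed

text \<open>\<open>chi\<close> is defined through \<open>Lim\<close>, whose value is meaningful only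
  when a limit exists; \<open>chi_exists\<close> provides it. The division by 2 undoes the factor in
  \<open>chi\<close>.\<close>

lemma chi_exists_imp_correlates:
  fixes v :: "real^'m \<Rightarrow> real^('p::finite + 'q::finite)"
  assumes "continuous_on UNIV v" "chi_exists \<mu> \<phi> v"
  shows "correlates (\<lambda>y. v y $ Inl i) (\<lambda>y. v y $ Inr j) (chi \<mu> \<phi> v $ i $ j / 2)"
proof -
  obtain L where L: "((\<lambda>T. integral {0..T} (corr \<mu> \<phi> v)) \<longlongrightarrow> L) at_top"
    using assms(2) by (auto simp: chi_exists_def)
  then have "chi \<mu> \<phi> v = 2 *\<^sub>R L" by (simp add: chi_def tendsto_Lim)
  moreover have "((\<lambda>T. integral {0..T} (corr \<mu> \<phi> v) $ i $ j) \<longlongrightarrow> L $ i $ j) at_top"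
    by (intro tendsto_vec_nth L)
  ultimately show ?thesis by (simp add: correlates_def integral_corr_nth[OF assms(1)])
qed

lemma chi_eqI:
  fixes v :: "real^'m \<Rightarrow> real^('p::finite + 'q::finite)"
  assumes "continuous_on UNIV v"
    and "\<And>i j. correlates (\<lambda>y. v y $ Inl i) (\<lambda>y. v y $ Inr j) (E $ i $ j / 2)"
  shows "chi \<mu> \<phi> v = E"
proof -
  have "((\<lambda>T. integral {0..T} (corr \<mu> \<phi> v)) \<longlongrightarrow> (1 / 2) *\<^sub>R E) at_top"
    using assms by (intro vec_tendstoI) (simp add: integral_corr_nth correlates_def)
  then show ?thesis by (simp add: chi_def tendsto_Lim)
qed

end

section \<open>The perturbation\<close>

theorem theorem5p3:
  fixes r :: nat
    and \<Lambda> :: "(real^'m::finite) set"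
    and g :: "real^'m \<Rightarrow> real^'m"
    and \<phi> :: "real \<Rightarrow> real^'m \<Rightarrow> real^'m"
    and \<mu> :: "(real^'m) measure"
    and R :: "real^'m^'m"
    and v0 :: "real^'m \<Rightarrow> real^('p::finite + 'q::finite)"
  assumes r: "r \<ge> 1"
    and Lambda: "compact \<Lambda>"
    and g: "Ck r g"
    and flow: "flow_on g \<Lambda> \<phi>"
    and prob: "prob_space \<mu>"
    and space: "space \<mu> = \<Lambda>"
    and sets: "sets \<mu> = sets (restrict_space borel \<Lambda>)"
    and inv: "flow_invariant \<mu> \<phi>"
    and erg: "flow_ergodic \<mu> \<phi>"
    and mix: "flow_mixing \<mu> \<phi>"
    and R2: "R ** R = mat 1"
    and RLambda: "(\<lambda>y. R *v y) ` \<Lambda> = \<Lambda>"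
    and Rinv: "distr \<mu> \<mu> (\<lambda>y. R *v y) = \<mu>"
    and rev: "\<forall>y\<in>\<Lambda>. g (R *v y) = - (R *v g y)"
    and nondirac: "\<not> is_dirac \<mu>"
    and lim: "\<forall>v :: real^'m \<Rightarrow> real^('p + 'q). admissible r R \<mu> v \<longrightarrow> chi_exists \<mu> \<phi> v"
    and v0: "admissible r R \<mu> v0"
  shows "\<forall>K \<epsilon>. compact K \<and> \<epsilon> > 0 \<longrightarrow>
    (\<exists>\<eta>>0. \<forall>E :: real^'q^'p. rank E = min CARD('p) CARD('q) \<and> norm (E - chi \<mu> \<phi> v0) < \<eta> \<longrightarrow>
       (\<exists>v. admissible r R \<mu> v \<and> Crnorm r K (\<lambda>x. v x - v0 x) < \<epsilon> \<and> chi \<mu> \<phi> v = E))"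
proof (intro allI impI)
  fix K :: "(real^'m) set" and \<epsilon> :: real
  assume "compact K \<and> \<epsilon> > 0"
  then have K: "compact K" and \<epsilon>: "\<epsilon> > 0" by auto
  interpret prob_space \<mu> by (rule prob)
  interpret mixing_flow \<mu> \<Lambda> g \<phi>
    by unfold_locales (rule Lambda space sets flow inv mix Ck_imp_continuous[OF g])+
  note adm = admissibleD[OF v0]
  have Ckv0: "Ck r v0" using v0 by (simp add: admissible_def)
  define up where "up i x = v0 x $ Inl i" for i x
  define um where "um j x = v0 x $ Inr j" for j x
  have Cku: "Ck r (up i)" "Ck r (um j)" for i j
    using adm(1) by (simp_all add: up_def[abs_def] um_def[abs_def])
  note cup = Ck_imp_continuous[OF Cku(1)] and cum = Ck_imp_continuous[OF Cku(2)]
  have um_lim: "\<exists>L. correlates f (um j) L"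
    if f: "\<And>k. Ck k f" "\<And>x. f (R *v x) = f x" "integral\<^sup>L \<mu> f = 0" for f j
  proof -
    \<comment> \<open>An auxiliary admissible function with f in every even coordinate and the odd
      part of v0: applying \<open>lim\<close> to it yields the limit for the pair f,
      \<open>um j\<close>.\<close>
    define v :: "real^'m \<Rightarrow> real^('p + 'q)" where
      "v x = (\<chi> k. case k of Inl i \<Rightarrow> f x | Inr j \<Rightarrow> um j x)" for x
    have "Ck r (\<lambda>x. v x $ k)" for k
      using f(1) Cku by (cases k) (auto simp: v_def)
    then have "admissible r R \<mu> v"
      by (rule admissibleI[OF Rinv RLambda]) (use f adm(4) in \<open>auto simp: v_def um_def\<close>)
    then have "chi_exists \<mu> \<phi> v" "continuous_on UNIV v"
      using lim Ck_imp_continuous by (auto simp: admissible_def)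
    \<comment> \<open>All even coordinates of v equal f, so any index, here
      \<open>undefined\<close>, will do.\<close>
    then show ?thesis
      using chi_exists_imp_correlates[of v undefined j] by (auto simp: v_def)
  qed
  have "\<exists>f :: 'p \<Rightarrow> real^'m \<Rightarrow> real. (\<forall>i k. Ck k (f i)) \<and> (\<forall>i x. f i (R *v x) = f i x) \<and>
    (\<forall>i. integral\<^sup>L \<mu> (f i) = 0) \<and> (\<forall>i j. (\<integral>y. up i y * f j y \<partial>\<mu>) = 0) \<and>
    (\<forall>i j. (\<integral>y. f i y * f j y \<partial>\<mu>) = (if i = j then 1 else 0)) \<and>
    (\<forall>i j. correlates (f i) (um j) 0)"
    by (rule ex_orthonormal_frame[OF nondirac R2 cup cum]) (rule um_lim)
  then obtain f :: "'p \<Rightarrow> real^'m \<Rightarrow> real" where f': "(\<forall>i k. Ck k (f i)) \<and> (\<forall>i x. f i (R *v x) = f i x) \<and>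
    (\<forall>i. integral\<^sup>L \<mu> (f i) = 0) \<and> (\<forall>i j. (\<integral>y. up i y * f j y \<partial>\<mu>) = 0) \<and>
    (\<forall>i j. (\<integral>y. f i y * f j y \<partial>\<mu>) = (if i = j then 1 else 0)) \<and>
    (\<forall>i j. correlates (f i) (um j) 0)" ..
  have f: "\<And>i k. Ck k (f i)" "\<And>i x. f i (R *v x) = f i x"
    "\<And>i. integral\<^sup>L \<mu> (f i) = 0" "\<And>i j. (\<integral>y. up i y * f j y \<partial>\<mu>) = 0"
    "\<And>i j. (\<integral>y. f i y * f j y \<partial>\<mu>) = (if i = j then 1 else 0)"
    "\<And>i j. correlates (f i) (um j) 0"
    using f' by simp_all
  note cf = Ck_imp_continuous[OF f(1)]
  \<comment> \<open>The functions f i are smooth of every order, so after losing one derivative and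
    being multiplied by components of g they are still of class $C^r$.\<close>
  have Ckl: "Ck r (lie g (f i))" for i by (intro Ck_lie f g)
  note cl = Ck_imp_continuous[OF Ckl]
  have lodd: "lie g (f i) (R *v y) = - lie g (f i) y" if "y \<in> \<Lambda>" for i y
    using that rev f(1)[of 1 i] by (intro lie_odd f(2)) auto

  \<comment> \<open>\<open>W1\<close> moves the even coordinates and \<open>W2 (k, j)\<close> puts
    the Lie derivative of f k into the odd coordinate j. They are fixed before E is given, so the
    bounds on their norms, and hence \<eta>, do not depend on E.\<close>
  define W1 :: "real^'m \<Rightarrow> real^('p + 'q)" where "W1 x = (\<Sum>i\<in>UNIV. f i x *\<^sub>R axis (Inl i) 1)" for x
  define W2 :: "'p \<times> 'q \<Rightarrow> real^'m \<Rightarrow> real^('p + 'q)" where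
    "W2 = (\<lambda>(k, j) x. lie g (f k) x *\<^sub>R axis (Inr j) 1)"
  have W1: "Ck r W1"
    unfolding W1_def[abs_def] by (intro Ck_sum Ck_bounded_linear[OF bounded_linear_scaleR_left] f)
  have W2: "Ck r (W2 z)" for z
    unfolding W2_def by (cases z) (auto intro!: Ck_bounded_linear[OF bounded_linear_scaleR_left] Ckl)
  define C1 where "C1 = Crnorm r K W1"
  define C2 where "C2 = (\<Sum>z\<in>UNIV. Crnorm r K (W2 z))"
  have C: "C1 \<ge> 0" "C2 \<ge> 0"
    unfolding C1_def C2_def using Crnorm_nonneg[OF K] W1 W2 by (auto intro!: sum_nonneg)
  \<comment> \<open>The even part of the perturbation uses up less than half of \<epsilon>. Adding 1
    to C1, and below to C2, avoids division by zero.\<close>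
  define \<delta> where "\<delta> = \<epsilon> / (2 * (C1 + 1))"
  have \<delta>: "\<delta> > 0" "\<delta> * C1 < \<epsilon> / 2" using C \<epsilon> by (auto simp: \<delta>_def field_simps)
  \<comment> \<open>The odd coefficients grow like 1/\<delta>, so \<delta> is fixed first. They will
    be bounded by \<eta>/(2\<delta>), and \<eta> is chosen so that this bound times C2 is at most
    \<epsilon>/2.\<close>
  define \<eta> where "\<eta> = \<delta> * \<epsilon> / (C2 + 1)"
  have \<eta>_\<delta>: "\<eta> / (2 * \<delta>) = \<epsilon> / (2 * (C2 + 1))" using \<delta>(1) by (simp add: \<eta>_def)
  have \<eta>: "\<eta> > 0" "\<eta> / (2 * \<delta>) * C2 \<le> \<epsilon> / 2"
    unfolding \<eta>_\<delta> using C \<delta>(1) \<epsilon> by (simp_all add: \<eta>_def field_simps)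
  show "\<exists>\<eta>>0. \<forall>E :: real^'q^'p. rank E = min CARD('p) CARD('q) \<and> norm (E - chi \<mu> \<phi> v0) < \<eta> \<longrightarrow>
       (\<exists>v. admissible r R \<mu> v \<and> Crnorm r K (\<lambda>x. v x - v0 x) < \<epsilon> \<and> chi \<mu> \<phi> v = E)"
  proof (intro exI[of _ \<eta>] conjI allI impI \<eta>(1))
    fix E :: "real^'q^'p"
    assume "rank E = min CARD('p) CARD('q) \<and> norm (E - chi \<mu> \<phi> v0) < \<eta>"
    then have E: "norm (E - chi \<mu> \<phi> v0) < \<eta>" by simp
    \<comment> \<open>The (i, j) correlation limit of the perturbed function will be half the entry
      of \<open>chi \<mu> \<phi> v0\<close> minus \<delta> times \<open>a (i, j)\<close>; setting
      this equal to half the entry of E determines a.\<close>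
    define a where "a = (\<lambda>(k, j). - ((E - chi \<mu> \<phi> v0) $ k $ j) / (2 * \<delta>))"
    have a: "\<bar>a z\<bar> \<le> \<eta> / (2 * \<delta>)" for z
    proof -
      obtain k j where z: "z = (k, j)" by (cases z)
      have "\<bar>(E - chi \<mu> \<phi> v0) $ k $ j\<bar> \<le> norm ((E - chi \<mu> \<phi> v0) $ k)"
        by (rule component_le_norm_cart)
      also have "\<dots> \<le> norm (E - chi \<mu> \<phi> v0)" by (rule Finite_Cartesian_Product.norm_nth_le)
      finally have "\<bar>(E - chi \<mu> \<phi> v0) $ k $ j\<bar> \<le> \<eta>" using E by simp
      then show ?thesis using \<delta>(1) by (simp add: a_def z divide_right_mono)
    qed
    define w where "w x = \<delta> *\<^sub>R W1 x + (\<Sum>z\<in>UNIV. a z *\<^sub>R W2 z x)" for x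
    define v where "v x = v0 x + w x" for x
    have wl: "w x $ Inl i = \<delta> * f i x" for x i
      by (simp add: w_def W1_def W2_def axis_def if_distrib split_def cong: if_cong)
    have wr: "w x $ Inr j = (\<Sum>k\<in>UNIV. a (k, j) * lie g (f k) x)" for x j
    proof -
      have "w x $ Inr j = (\<Sum>(k, j')\<in>UNIV \<times> UNIV. if j' = j then a (k, j') * lie g (f k) x else 0)"
        by (auto simp: w_def W1_def W2_def axis_def intro!: sum.cong)
      also have "\<dots> = (\<Sum>k\<in>UNIV. \<Sum>j'\<in>UNIV. if j' = j then a (k, j') * lie g (f k) x else 0)"
        by (rule sum.cartesian_product[symmetric])
      finally show ?thesis by simp
    qed
    have Ckw: "Ck r w"
      unfolding w_def[abs_def] by (intro Ck_add Ck_sum Ck_scaleR W1 W2)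
    have Ckv: "Ck r v" unfolding v_def[abs_def] by (intro Ck_add Ckv0 Ckw)
    have "Crnorm r K (\<lambda>x. v x - v0 x) < \<epsilon>"
    proof -
      have "Crnorm r K w \<le> Crnorm r K (\<lambda>x. \<delta> *\<^sub>R W1 x) + Crnorm r K (\<lambda>x. \<Sum>z\<in>UNIV. a z *\<^sub>R W2 z x)"
        unfolding w_def[abs_def] by (intro Crnorm_add K Ck_sum Ck_scaleR W1 W2)
      also have "\<dots> \<le> \<bar>\<delta>\<bar> * C1 + (\<Sum>z\<in>UNIV. Crnorm r K (\<lambda>x. a z *\<^sub>R W2 z x))"
        unfolding C1_def by (intro add_mono Crnorm_scaleR Crnorm_sum K W1 W2 Ck_scaleR)
      also have "(\<Sum>z\<in>UNIV. Crnorm r K (\<lambda>x. a z *\<^sub>R W2 z x)) \<le> (\<Sum>z\<in>UNIV. \<eta> / (2 * \<delta>) * Crnorm r K (W2 z))"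
        by (intro sum_mono order_trans[OF Crnorm_scaleR[OF K W2]] mult_right_mono a Crnorm_nonneg[OF K W2])
      also have "\<dots> = \<eta> / (2 * \<delta>) * C2" by (simp add: C2_def sum_distrib_left)
      also have "\<dots> \<le> \<epsilon> / 2" by (rule \<eta>(2))
      finally have "Crnorm r K w < \<epsilon>" using \<delta> by simp
      then show ?thesis by (simp add: v_def)
    qed
    moreover have "admissible r R \<mu> v"
    proof (rule admissibleI[OF Rinv RLambda])
      show "Ck r (\<lambda>x. v x $ k)" for k by (rule Ck_nth[OF Ckv])
      show "v (R *v y) $ Inl i = v y $ Inl i" if "y \<in> \<Lambda>" for y i
        using adm(3)[OF that] f(2) by (simp add: v_def wl)
      show "v (R *v y) $ Inr j = - v y $ Inr j" if "y \<in> \<Lambda>" for y j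
        using adm(4)[OF that] lodd[OF that] by (simp add: v_def wr sum_negf)
      show "integral\<^sup>L \<mu> (\<lambda>x. v x $ Inl i) = 0" for i
        using adm(2)[of "Inl i"] f(3) integrable_cont[OF cup[of i]] integrable_cont[OF cf[of i]]
        by (simp add: v_def wl up_def[abs_def])
    qed
    moreover have "chi \<mu> \<phi> v = E"
    proof (rule chi_eqI[OF Ck_imp_continuous[OF Ckv]])
      fix i j
      have vl: "(\<lambda>y. v y $ Inl i) = (\<lambda>y. up i y + \<delta> * f i y)"
        and vr: "(\<lambda>y. v y $ Inr j) = (\<lambda>y. um j y + (\<Sum>k\<in>UNIV. a (k, j) * lie g (f k) y))"
        by (simp_all add: v_def wl wr up_def um_def)
      have c\<delta>: "continuous_on UNIV (\<lambda>y. \<delta> * f i y)" by (intro continuous_intros cf)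
      have ca: "continuous_on UNIV (\<lambda>y. a (k, j) * lie g (f k) y)" for k by (intro continuous_intros cl)
      have cs: "continuous_on UNIV (\<lambda>y. \<Sum>k\<in>UNIV. a (k, j) * lie g (f k) y)" by (intro continuous_intros ca)
      have uu: "correlates (up i) (um j) (chi \<mu> \<phi> v0 $ i $ j / 2)"
        using chi_exists_imp_correlates[OF Ck_imp_continuous[OF Ckv0], of i j] lim v0
        by (simp add: up_def[abs_def] um_def[abs_def])
      have ul: "correlates (up i) (\<lambda>y. \<Sum>k\<in>UNIV. a (k, j) * lie g (f k) y)
          (\<Sum>k\<in>UNIV. a (k, j) * - (\<integral>y. up i y * f k y \<partial>\<mu>))"
        by (intro correlates_sum_right correlates_cmult_right correlates_lie cup ca f)
      have fl: "correlates (f i) (\<lambda>y. \<Sum>k\<in>UNIV. a (k, j) * lie g (f k) y)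
          (\<Sum>k\<in>UNIV. a (k, j) * - (\<integral>y. f i y * f k y \<partial>\<mu>))"
        by (intro correlates_sum_right correlates_cmult_right correlates_lie cf ca f)
      \<comment> \<open>Bilinear expansion into four terms: old with old gives half of chi at v0,
        old even with new odd vanishes by orthogonality to \<open>up i\<close>, new even with old
        odd vanishes by the choice of f, and new with new gives -\<delta> times
        \<open>a (i, j)\<close> by orthonormality.\<close>
      have "correlates (\<lambda>y. v y $ Inl i) (\<lambda>y. v y $ Inr j)
          ((chi \<mu> \<phi> v0 $ i $ j / 2 + (\<Sum>k\<in>UNIV. a (k, j) * - (\<integral>y. up i y * f k y \<partial>\<mu>)))
           + \<delta> * (0 + (\<Sum>k\<in>UNIV. a (k, j) * - (\<integral>y. f i y * f k y \<partial>\<mu>))))"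
        unfolding vl vr
        by (intro correlates_add_left correlates_add_right correlates_cmult_left uu ul fl f(6)
            cup cum cf cs c\<delta> continuous_on_add)
      moreover have "(chi \<mu> \<phi> v0 $ i $ j / 2 + (\<Sum>k\<in>UNIV. a (k, j) * - (\<integral>y. up i y * f k y \<partial>\<mu>)))
           + \<delta> * (0 + (\<Sum>k\<in>UNIV. a (k, j) * - (\<integral>y. f i y * f k y \<partial>\<mu>))) = E $ i $ j / 2"
      proof -
        have up_sum: "(\<Sum>k\<in>UNIV. a (k, j) * - (\<integral>y. up i y * f k y \<partial>\<mu>)) = 0"
          by (simp add: f(4))
        have f_sum: "(\<Sum>k\<in>UNIV. a (k, j) * - (\<integral>y. f i y * f k y \<partial>\<mu>)) = - a (i, j)"
          by (simp add: f(5) if_distrib cong: if_cong)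
        have "\<delta> * a (i, j) = - (E $ i $ j - chi \<mu> \<phi> v0 $ i $ j) / 2"
          using \<delta>(1) by (simp add: a_def)
        then show ?thesis unfolding up_sum f_sum by (simp add: field_simps)
      qed
      ultimately show "correlates (\<lambda>y. v y $ Inl i) (\<lambda>y. v y $ Inr j) (E $ i $ j / 2)" by (simp only:)
    qed
    ultimately show "\<exists>v. admissible r R \<mu> v \<and> Crnorm r K (\<lambda>x. v x - v0 x) < \<epsilon> \<and> chi \<mu> \<phi> v = E" by blast
  qed
qed

end
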